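(* Let $q$ be a prime power, let $F$ be the field with $q^2$ elements, and let $m,n$ be positive integers with $n \ge 2m$. The number of nilpotent orbits of $\mathrm{GU}_m(q) \times \mathrm{GU}_n(q)$ on $M_{m \times n}(F)$ is $$\sum p(m_1)\,p(m_2)\,p(m_3),$$ where the sum is over all triples $(m_1,m_2,m_3)$ of non-negative integers with $m_1 + m_2 + 2m_3 = m$.
   Context: For a matrix $A$ over $F=\mathbb{F}_{q^2}$, $A^*$ is the transpose of the matrix obtained by raising all entries to the $q$-th power, and $\mathrm{GU}_n(q) = \{X \in \mathrm{GL}_n(F) : XX^*=I\}$. The group $\mathrm{GU}_m(q)\times \mathrm{GU}_n(q)$ acts on $M_{m\times n}(F)$ by $(X,Y): A \mapsto XAY^*$. An orbit is nilpotent if $AA^*$ is nilpotent for $A$ in the orbit. $p(d)$ denotes the number of partitions of $d$ (with $p(0)=1$). *)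

theory Defs
  imports
    "Jordan_Normal_Form.Matrix"
    "HOL-Algebra.Group_Action"
    "HOL-Number_Theory.Prime_Powers"
    "HOL-Library.Cardinality"
    "HOL-Library.Multiset"
begin

text \<open>
  The field with \<open>q\<^sup>2\<close> elements is rendered as an arbitrary type of sort \<open>finite_field\<close> of
  cardinality \<open>q\<^sup>2\<close>, so \<open>q\<close> appears as an explicit parameter below.
\<close>

definition conj_transpose :: "nat \<Rightarrow> 'a :: field mat \<Rightarrow> 'a mat" where
  "conj_transpose q A = transpose_mat (map_mat (\<lambda>x. x ^ q) A)"

definition GL :: "'a :: field itself \<Rightarrow> nat \<Rightarrow> 'a mat monoid" where
  "GL ty n = units_of (ring_mat ty n ())"

definition GU :: "'a :: field itself \<Rightarrow> nat \<Rightarrow> nat \<Rightarrow> 'a mat monoid" where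
  "GU ty q n =
     (GL ty n)\<lparr>carrier := {X \<in> carrier (GL ty n). X * conj_transpose q X = 1\<^sub>m n}\<rparr>"

text \<open>
  The action is restricted to the set acted upon because \<^locale>\<open>group_action\<close> requires
  extensional permutations.
\<close>

definition GU_action :: "nat \<Rightarrow> nat \<Rightarrow> nat \<Rightarrow> 'a :: field mat \<times> 'a mat \<Rightarrow> 'a mat \<Rightarrow> 'a mat" where
  "GU_action q m n = (\<lambda>(X, Y). \<lambda>A \<in> carrier_mat m n. X * A * conj_transpose q Y)"

definition GU_orbits :: "'a :: field itself \<Rightarrow> nat \<Rightarrow> nat \<Rightarrow> nat \<Rightarrow> 'a mat set set" where
  "GU_orbits ty q m n = orbits (GU ty q m \<times>\<times> GU ty q n) (carrier_mat m n) (GU_action q m n)"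

definition nilpotent_mat :: "'a :: semiring_1 mat \<Rightarrow> bool" where
  "nilpotent_mat B \<longleftrightarrow> square_mat B \<and> (\<exists>k. B ^\<^sub>m k = 0\<^sub>m (dim_row B) (dim_col B))"

definition nilpotent_orbits :: "'a :: field itself \<Rightarrow> nat \<Rightarrow> nat \<Rightarrow> nat \<Rightarrow> 'a mat set set" where
  "nilpotent_orbits ty q m n =
     {\<O> \<in> GU_orbits ty q m n. \<forall>A \<in> \<O>. nilpotent_mat (A * conj_transpose q A)}"

text \<open>A partition of \<open>d\<close> is the multiset of its (positive) parts.\<close>

definition partitions :: "nat \<Rightarrow> nat multiset set" where
  "partitions d = {P. 0 \<notin># P \<and> \<Sum>\<^sub># P = d}"

definition num_partitions :: "nat \<Rightarrow> nat" where
  "num_partitions d = card (partitions d)"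

end

theory Submission
  imports Defs "HOL-Number_Theory.Residues" "HOL-Computational_Algebra.Polynomial"
begin

text \<open>
  A matrix \<open>A\<close> is a linear map from the standard hermitian space \<open>W\<close> of dimension \<open>n\<close> to the
  standard hermitian space \<open>V\<close> of dimension \<open>m\<close>. Together with its adjoint it forms a
  self-adjoint operator \<open>T\<close> on the orthogonal sum of \<open>V\<close> and \<open>W\<close> that exchanges the two
  summands, and \<open>A A\<^sup>\<dagger>\<close> is nilpotent iff \<open>T\<close> is. Such an operator decomposes into chains
  \<open>x, T x, T\<^sup>2 x, \<dots>\<close> alternating between \<open>V\<close> and \<open>W\<close>. As the form pairs the two ends of a chain,
  a chain of odd length is a nondegenerate summand, whereas chains of even length are isotropic
  and come in dual pairs. Over a finite field nondegenerate hermitian forms are classified by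
  their dimension, so that the orbit is determined by the multiplicities of three kinds of
  summands: odd chains starting in \<open>V\<close>, odd chains starting in \<open>W\<close>, and pairs of even chains.
  Counting the vectors in \<open>V\<close> gives three partitions of numbers with
  \<open>m1 + m2 + 2 * m3 = m\<close>. The only chains that do not meet \<open>V\<close> are single vectors of \<open>W\<close>; their
  number is determined by \<open>n\<close>, and for \<open>2 * m \<le> n\<close> it is never negative.

  The classification is proved without splitting off chains. A matrix \<open>A\<close> has a derived matrix,
  the restriction of \<open>T\<close> to the image of \<open>T\<^sup>2\<close>, which amounts to deleting both ends of all chains,
  and whose rank is smaller if \<open>A A\<^sup>\<dagger>\<close> is nilpotent and \<open>A \<noteq> 0\<close>. Up to equivalence \<open>A\<close>
  determines its derived matrix (\<open>derived_unique\<close>), is determined by it together with \<open>m\<close>, \<open>n\<close> and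
  the rank (\<open>derived_reflects_equiv\<close>), and every derived matrix that satisfies the obvious
  dimension inequalities occurs (\<open>derived_bounds\<close>, \<open>derived_surj\<close>). The slacks in these
  inequalities are the numbers of chains of length 1 and 2, so the type of \<open>A\<close> is obtained by
  recursion.

  The geometric input is Witt's theorem for subspaces that may be degenerate (\<open>witt\<close>), the
  factorisation of every hermitian matrix as \<open>D\<^sup>\<dagger> D\<close> with \<open>D\<close> surjective
  (\<open>hermitian_factorisation\<close>), and a statement of pure linear algebra about the factorisations of
  a matrix through an intermediate space (\<open>factorisations_conjugate\<close>).
\<close>

section \<open>Finite fields with an involution\<close>

text \<open>
  Pigeonhole for maps with small fibres: it turns the bound on the number of roots of a
  polynomial into the surjectivity of the trace and of the norm.
\<close>
lemma surj_if_small_fibres: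
  fixes f :: "'b \<Rightarrow> 'c"
  assumes A: "finite A" "card A = a * b" and T: "finite T" "card T \<le> a"
    and f: "f ` A \<subseteq> T" and fib: "\<And>y. y \<in> T \<Longrightarrow> card {x \<in> A. f x = y} \<le> b"
    and b: "0 < b" and c: "c \<in> T"
  shows "\<exists>x\<in>A. f x = c"
proof (rule ccontr)
  assume neg: "\<not> (\<exists>x\<in>A. f x = c)"
  have "card A = (\<Sum>y\<in>T. card {x \<in> A. f x = y})"
  proof -
    have "A = (\<Union>y\<in>T. {x \<in> A. f x = y})" using f by auto
    then have "card A = card (\<Union>y\<in>T. {x \<in> A. f x = y})" by simp
    also have "\<dots> = (\<Sum>y\<in>T. card {x \<in> A. f x = y})"
      by (rule card_UN_disjoint) (use A T in auto)
    finally show ?thesis .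
  qed
  also have "\<dots> = (\<Sum>y\<in>T - {c}. card {x \<in> A. f x = y})"
  proof -
    have "card {x \<in> A. f x = c} = 0" using neg by (auto simp: card_eq_0_iff)
    then show ?thesis by (subst sum.remove[OF T(1) c]) simp
  qed
  also have "\<dots> \<le> (\<Sum>y\<in>T - {c}. b)" by (rule sum_mono) (use fib in auto)
  also have "\<dots> = (card T - 1) * b" using T c by simp
  also have "\<dots> < a * b"
  proof -
    have "card T > 0" using T c by (auto simp: card_gt_0_iff)
    then show ?thesis using T(2) b by auto
  qed
  finally show False using A by simp
qed

locale unitary_field =
  fixes q :: nat and ty :: "'a :: finite_field itself"
  assumes primepow_q: "primepow q" and card_field: "CARD('a) = q\<^sup>2"
begin

lemma q_gt_1: "q > 1"
  using primepow_q primepow_gt_Suc_0 by auto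

lemma q_pos [simp]: "0 < q"
  using q_gt_1 by simp

lemma frobenius_add: "(x + y :: 'a) ^ q = x ^ q + y ^ q"
proof -
  obtain p k where p: "prime p" "k > 0" "q = p ^ k"
    using primepow_q unfolding primepow_def by auto
  have pc: "prime CHAR('a)"
    by (rule prime_CHAR_semidom) (rule CHAR_pos)
  have "CHAR('a) dvd CARD('a)" by (rule CHAR_dvd_CARD)
  then have "CHAR('a) dvd p ^ (k * 2)" by (simp add: card_field p power_mult)
  then have "CHAR('a) dvd p" using pc prime_dvd_power by blast
  then have "CHAR('a) = p" using pc p(1) primes_dvd_imp_eq by blast
  then show ?thesis using freshmans_dream'[OF pc, of q k x y] p by simp
qed

lemma frobenius_twice: "((x :: 'a) ^ q) ^ q = x"
  using finite_field_power_card_eq_same[of x] by (simp add: card_field power_mult power2_eq_square)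

lemma frobenius_0 [simp]: "(0 :: 'a) ^ q = 0"
  using q_gt_1 by auto

lemma frobenius_sum: "(sum f A :: 'a) ^ q = (\<Sum>i\<in>A. f i ^ q)"
  by (induction A rule: infinite_finite_induct) (simp_all add: frobenius_add)

lemma frobenius_minus: "(- x :: 'a) ^ q = - (x ^ q)"
  by (metis frobenius_0 frobenius_add add.right_inverse add_eq_0_iff)

lemma trace_surj:
  assumes c: "(c :: 'a) ^ q = c"
  shows "\<exists>x. x + x ^ q = c"
proof -
  have roots: "card {x :: 'a. x + x ^ q = y} \<le> q" for y
  proof -
    let ?p = "monom 1 q + [:- y, 1:] :: 'a poly"
    have "coeff ?p q = 1" using q_gt_1
      by (auto simp: coeff_pCons split: nat.split)
    then have "?p \<noteq> 0" by (metis coeff_0 zero_neq_one)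
    then have "card {x. poly ?p x = 0} \<le> degree ?p" by (rule card_poly_roots_bound)
    also have "degree ?p \<le> q"
      by (intro degree_add_le degree_monom_le) (use q_gt_1 in auto)
    also have "{x. poly ?p x = 0} = {x. x + x ^ q = y}"
      by (auto simp: poly_monom algebra_simps)
    finally show ?thesis .
  qed
  have fixed: "card {x :: 'a. x ^ q = x} \<le> q"
  proof -
    let ?p = "monom 1 q - [:0, 1:] :: 'a poly"
    have "coeff ?p q = 1" using q_gt_1
      by (auto simp: coeff_pCons split: nat.split)
    then have "?p \<noteq> 0" by (metis coeff_0 zero_neq_one)
    then have "card {x. poly ?p x = 0} \<le> degree ?p" by (rule card_poly_roots_bound)
    also have "degree ?p \<le> q"
      by (intro degree_diff_le degree_monom_le) (use q_gt_1 in auto)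
    also have "{x. poly ?p x = 0} = {x. x ^ q = x}"
      by (auto simp: poly_monom algebra_simps)
    finally show ?thesis .
  qed
  have "\<exists>x\<in>(UNIV :: 'a set). x + x ^ q = c"
    by (rule surj_if_small_fibres[where a = q and b = q and T = "{x. x ^ q = x}"])
      (use roots fixed c q_gt_1 in
        \<open>auto simp: card_field power2_eq_square frobenius_add frobenius_twice add.commute\<close>)
  then show ?thesis by auto
qed

lemma norm_surj:
  assumes c: "(c :: 'a) ^ q = c" and nz: "c \<noteq> 0"
  shows "\<exists>x. x \<noteq> 0 \<and> x * x ^ q = c"
proof -
  have pow: "card {x :: 'a. x ^ k = y} \<le> k" if "k > 0" for k y
  proof -
    let ?p = "monom 1 k - [:y:] :: 'a poly"
    have "coeff ?p k = 1" using that by (auto simp: coeff_pCons split: nat.split)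
    then have "?p \<noteq> 0" by (metis coeff_0 zero_neq_one)
    then have "card {x. poly ?p x = 0} \<le> degree ?p" by (rule card_poly_roots_bound)
    also have "degree ?p \<le> k" by (intro degree_diff_le degree_monom_le) auto
    also have "{x. poly ?p x = 0} = {x. x ^ k = y}" by (auto simp: poly_monom)
    finally show ?thesis .
  qed
  have unit: "y ^ (q - 1) = 1" if "y ^ q = y" "y \<noteq> 0" for y :: 'a
  proof -
    have "y * y ^ (q - 1) = y * 1" using that q_gt_1 by (simp flip: power_Suc)
    then show ?thesis using that by simp
  qed
  have fix_norm: "(x * x ^ q) ^ q = x * x ^ q" for x :: 'a
    by (simp add: power_mult_distrib frobenius_twice)
  have "\<exists>x\<in>UNIV - {0 :: 'a}. x * x ^ q = c"
  proof (rule surj_if_small_fibres[where a = "q - 1" and b = "q + 1" and T = "{x. x ^ (q - 1) = 1}"])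
    have "(q - 1) * (q + 1) = q\<^sup>2 - 1" by (simp add: algebra_simps power2_eq_square)
    then show "card (UNIV - {0 :: 'a}) = (q - 1) * (q + 1)"
      by (simp add: card_Diff_singleton card_field)
    show "card {x \<in> UNIV - {0 :: 'a}. x * x ^ q = y} \<le> q + 1" for y
      by (rule order_trans[OF card_mono pow[of "q + 1" y]]) auto
    show "(\<lambda>x. x * x ^ q) ` (UNIV - {0 :: 'a}) \<subseteq> {x. x ^ (q - 1) = 1}"
      using unit[OF fix_norm] by auto
  qed (use pow[of "q - 1" 1] unit[OF c nz] q_gt_1 in auto)
  then show ?thesis by auto
qed

end

section \<open>Finitely supported matrices\<close>

text \<open>
  Rectangular matrices of all formats live together in one ring without unit: a finitely
  supported matrix has format \<open>m \<times> n\<close> iff it is fixed by the idempotents \<open>idm m\<close> on the left and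
  \<open>idm n\<close> on the right. Block decompositions and changes of format become equations between
  products, with an unconditional associative law.
\<close>
typedef (overloaded) 'a fsmat =
  "{f :: nat \<Rightarrow> nat \<Rightarrow> 'a :: zero. \<exists>N. \<forall>i j. f i j \<noteq> 0 \<longrightarrow> i < N \<and> j < N}"
  morphisms ent Fsmat
  by (rule exI[of _ "\<lambda>_ _. 0"]) auto

setup_lifting type_definition_fsmat

lemma fsmat_eqI: "(\<And>i j. ent A i j = ent B i j) \<Longrightarrow> A = B"
  by (metis ent_inject ext)

lemma finite_row [simp]: "finite {k. ent A i k \<noteq> 0}"
proof -
  obtain N where "\<forall>i j. ent A i j \<noteq> 0 \<longrightarrow> i < N \<and> j < N" using ent[of A] by auto
  then have "{k. ent A i k \<noteq> 0} \<subseteq> {..<N}" by auto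
  then show ?thesis using finite_subset by blast
qed

instantiation fsmat :: (ring) ring
begin

lift_definition zero_fsmat :: "'a fsmat" is "\<lambda>_ _. 0" by auto

lift_definition plus_fsmat :: "'a fsmat \<Rightarrow> 'a fsmat \<Rightarrow> 'a fsmat" is "\<lambda>f g i j. f i j + g i j"
proof -
  fix f g :: "nat \<Rightarrow> nat \<Rightarrow> 'a"
  assume "\<exists>N. \<forall>i j. f i j \<noteq> 0 \<longrightarrow> i < N \<and> j < N" "\<exists>N. \<forall>i j. g i j \<noteq> 0 \<longrightarrow> i < N \<and> j < N"
  then obtain N M where "\<forall>i j. f i j \<noteq> 0 \<longrightarrow> i < N \<and> j < N" "\<forall>i j. g i j \<noteq> 0 \<longrightarrow> i < M \<and> j < M"
    by blast
  then show "\<exists>N. \<forall>i j. f i j + g i j \<noteq> 0 \<longrightarrow> i < N \<and> j < N"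
    by (intro exI[of _ "max N M"]) (metis add_0 less_max_iff_disj)
qed

lift_definition uminus_fsmat :: "'a fsmat \<Rightarrow> 'a fsmat" is "\<lambda>f i j. - f i j" by simp

definition minus_fsmat :: "'a fsmat \<Rightarrow> 'a fsmat \<Rightarrow> 'a fsmat" where
  "minus_fsmat A B = A + (- B)"

lift_definition times_fsmat :: "'a fsmat \<Rightarrow> 'a fsmat \<Rightarrow> 'a fsmat" is
  "\<lambda>f g i j. \<Sum>k | f i k \<noteq> 0. f i k * g k j"
proof -
  fix f g :: "nat \<Rightarrow> nat \<Rightarrow> 'a"
  assume "\<exists>N. \<forall>i j. f i j \<noteq> 0 \<longrightarrow> i < N \<and> j < N" "\<exists>N. \<forall>i j. g i j \<noteq> 0 \<longrightarrow> i < N \<and> j < N"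
  then obtain N M where N: "\<forall>i j. f i j \<noteq> 0 \<longrightarrow> i < N \<and> j < N"
    and M: "\<forall>i j. g i j \<noteq> 0 \<longrightarrow> i < M \<and> j < M" by blast
  have "i < max N M \<and> j < max N M" if nz: "(\<Sum>k | f i k \<noteq> 0. f i k * g k j) \<noteq> 0" for i j
  proof -
    obtain k where "k \<in> {k. f i k \<noteq> 0}" "f i k * g k j \<noteq> 0"
      using nz by (rule sum.not_neutral_contains_not_neutral)
    then have "f i k \<noteq> 0" "g k j \<noteq> 0" by auto
    then show ?thesis using N M \<open>k \<in> _\<close> by (auto simp: less_max_iff_disj)
  qed
  then show "\<exists>N. \<forall>i j. (\<Sum>k | f i k \<noteq> 0. f i k * g k j) \<noteq> 0 \<longrightarrow> i < N \<and> j < N" by blast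
qed

lemma ent_mult_bound:
  assumes "\<And>k. ent A i k \<noteq> 0 \<Longrightarrow> k < N"
  shows "ent (A * B) i j = (\<Sum>k<N. ent A i k * ent B k j)"
  unfolding times_fsmat.rep_eq
  by (rule sum.mono_neutral_left) (use assms in auto)

lemma fsmat_bound: "\<exists>N. \<forall>i j. ent (A :: 'a fsmat) i j \<noteq> 0 \<longrightarrow> i < N \<and> j < N"
  using ent[of A] by simp

instance
proof
  fix A B C :: "'a fsmat"
  show "A * B * C = A * (B * C)"
  proof (rule fsmat_eqI)
    fix i j
    obtain NA where NA: "\<forall>i j. ent A i j \<noteq> 0 \<longrightarrow> i < NA \<and> j < NA" using fsmat_bound by blast
    obtain NB where NB: "\<forall>i j. ent B i j \<noteq> 0 \<longrightarrow> i < NB \<and> j < NB" using fsmat_bound by blast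
    obtain N where N: "\<forall>i j. ent (A * B) i j \<noteq> 0 \<longrightarrow> i < N \<and> j < N" using fsmat_bound by blast
    define K where "K = max N (max NA NB)"
    have A: "ent (A * X) i j = (\<Sum>k<K. ent A i k * ent X k j)" for X i j
      by (rule ent_mult_bound) (use NA K_def in \<open>auto simp: less_max_iff_disj\<close>)
    have B: "ent (B * X) i j = (\<Sum>k<K. ent B i k * ent X k j)" for X i j
      by (rule ent_mult_bound) (use NB K_def in \<open>auto simp: less_max_iff_disj\<close>)
    have AB: "ent ((A * B) * X) i j = (\<Sum>k<K. ent (A * B) i k * ent X k j)" for X i j
      by (rule ent_mult_bound) (use N K_def in \<open>auto simp: less_max_iff_disj\<close>)
    have "ent (A * B * C) i j = (\<Sum>k<K. \<Sum>l<K. ent A i l * ent B l k * ent C k j)"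
      by (simp add: AB A sum_distrib_right)
    also have "\<dots> = (\<Sum>l<K. \<Sum>k<K. ent A i l * ent B l k * ent C k j)" by (rule sum.swap)
    also have "\<dots> = ent (A * (B * C)) i j" by (simp add: A B sum_distrib_left mult.assoc)
    finally show "ent (A * B * C) i j = ent (A * (B * C)) i j" .
  qed
  show "(A + B) * C = A * C + B * C"
  proof (rule fsmat_eqI)
    fix i j
    obtain NA where NA: "\<forall>i j. ent A i j \<noteq> 0 \<longrightarrow> i < NA \<and> j < NA" using fsmat_bound by blast
    obtain NB where NB: "\<forall>i j. ent B i j \<noteq> 0 \<longrightarrow> i < NB \<and> j < NB" using fsmat_bound by blast
    obtain N where N: "\<forall>i j. ent (A + B) i j \<noteq> 0 \<longrightarrow> i < N \<and> j < N" using fsmat_bound by blast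
    define K where "K = max N (max NA NB)"
    have "ent (A * C) i j = (\<Sum>k<K. ent A i k * ent C k j)"
      by (rule ent_mult_bound) (use NA K_def in \<open>auto simp: less_max_iff_disj\<close>)
    moreover have "ent (B * C) i j = (\<Sum>k<K. ent B i k * ent C k j)"
      by (rule ent_mult_bound) (use NB K_def in \<open>auto simp: less_max_iff_disj\<close>)
    moreover have "ent ((A + B) * C) i j = (\<Sum>k<K. ent (A + B) i k * ent C k j)"
      by (rule ent_mult_bound) (use N K_def in \<open>auto simp: less_max_iff_disj\<close>)
    ultimately show "ent ((A + B) * C) i j = ent (A * C + B * C) i j"
      by (simp add: plus_fsmat.rep_eq sum.distrib distrib_right)
  qed
  show "A * (B + C) = A * B + A * C"
    by (rule fsmat_eqI) (simp add: plus_fsmat.rep_eq times_fsmat.rep_eq distrib_left sum.distrib)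
  show "A + B + C = A + (B + C)" by (rule fsmat_eqI) (simp add: plus_fsmat.rep_eq add_ac)
  show "A + B = B + A" by (rule fsmat_eqI) (simp add: plus_fsmat.rep_eq add_ac)
  show "0 + A = A" by (rule fsmat_eqI) (simp add: plus_fsmat.rep_eq zero_fsmat.rep_eq)
  show "- A + A = 0"
    by (rule fsmat_eqI) (simp add: plus_fsmat.rep_eq uminus_fsmat.rep_eq zero_fsmat.rep_eq)
  show "A - B = A + - B" by (rule minus_fsmat_def)
qed

end

lemma ent_0 [simp]: "ent 0 i j = 0"
  by (simp add: zero_fsmat.rep_eq)

lemma ent_add [simp]: "ent (A + B) i j = ent A i j + ent B i j"
  by (simp add: plus_fsmat.rep_eq)

lemma ent_uminus [simp]: "ent (- A) i j = - ent A i j"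
  by (simp add: uminus_fsmat.rep_eq)

lemma ent_diff [simp]: "ent (A - B) i j = ent A i j - ent B i j" for A B :: "'a :: ring fsmat"
  unfolding minus_fsmat_def by (simp only: ent_add ent_uminus diff_conv_add_uminus)

text \<open>
  A piece of a diagonal: coordinate \<open>a + i\<close> is sent to coordinate \<open>i\<close>, scaled by \<open>c\<close>, for
  \<open>i < k\<close>. Identity matrices (\<open>a = 0\<close>), scalar matrices and the projections onto a block of
  coordinates are of this shape; \<open>X * shift a k\<close> moves \<open>k\<close> columns of \<open>X\<close> to the right by \<open>a\<close>,
  so that \<open>B + X * shift a k\<close> is the block matrix \<open>[B, X]\<close> if \<open>B\<close> has \<open>a\<close> columns.
\<close>
lift_definition band :: "'a :: ring_1 \<Rightarrow> nat \<Rightarrow> nat \<Rightarrow> 'a fsmat" is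
  "\<lambda>c a k i j. if i < k \<and> j = a + i then c else 0"
  subgoal for c a k by (rule exI[of _ "a + k"]) auto
  done

abbreviation shift :: "nat \<Rightarrow> nat \<Rightarrow> 'a :: ring_1 fsmat" where
  "shift \<equiv> band 1"

abbreviation idm :: "nat \<Rightarrow> 'a :: ring_1 fsmat" where
  "idm n \<equiv> band 1 0 n"

lift_definition single :: "nat \<Rightarrow> nat \<Rightarrow> 'a :: zero \<Rightarrow> 'a fsmat" is
  "\<lambda>i j c i' j'. if i' = i \<and> j' = j then c else 0"
  subgoal for i j c by (rule exI[of _ "Suc (max i j)"]) auto
  done

lemma ent_band_mult: "ent (band c a k * A) i j = (if i < k then c * ent A (a + i) j else 0)"
proof (cases "c = 0 \<or> \<not> i < k")
  case False
  then have "{l. ent (band c a k) i l \<noteq> 0} = {a + i}" by (auto simp: band.rep_eq)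
  then show ?thesis using False by (simp add: times_fsmat.rep_eq band.rep_eq)
qed (auto simp: times_fsmat.rep_eq band.rep_eq)

lemma ent_single_mult: "ent (single i j c * A) i' j' = (if i' = i then c * ent A j j' else 0)"
  for c :: "'a :: ring"
proof (cases "c = 0 \<or> i' \<noteq> i")
  case False
  then have "{l. ent (single i j c) i' l \<noteq> 0} = {j}" by (auto simp: single.rep_eq)
  then show ?thesis using False by (simp add: times_fsmat.rep_eq single.rep_eq)
qed (auto simp: times_fsmat.rep_eq single.rep_eq)

lemma ent_mult_single: "ent (A * single i j c) i' j' = (if j' = j then ent A i' i * c else 0)"
  for c :: "'a :: ring"
proof -
  have "ent (A * single i j c) i' j' =
      (\<Sum>k | ent A i' k \<noteq> 0. if k = i then (if j' = j then ent A i' i * c else 0) else 0)"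
    unfolding times_fsmat.rep_eq by (rule sum.cong) (auto simp: single.rep_eq)
  also have "\<dots> = (if j' = j then ent A i' i * c else 0)"
    by (subst sum.delta) auto
  finally show ?thesis .
qed

lemma ent_mult_idm: "ent (A * idm n) i j = (if j < n then ent A i j else 0)"
  for A :: "'a :: ring_1 fsmat"
proof -
  have "ent (A * idm n) i j =
      (\<Sum>k | ent A i k \<noteq> 0. if k = j then (if j < n then ent A i j else 0) else 0)"
    unfolding times_fsmat.rep_eq by (rule sum.cong) (auto simp: band.rep_eq)
  also have "\<dots> = (if j < n then ent A i j else 0)"
    by (subst sum.delta) auto
  finally show ?thesis .
qed

lemma idm_idm [simp]: "idm m * idm n = (idm (min m n) :: 'a :: ring_1 fsmat)"
  by (rule fsmat_eqI) (auto simp: ent_band_mult band.rep_eq)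

definition Mat :: "nat \<Rightarrow> nat \<Rightarrow> 'a :: ring_1 fsmat set" where
  "Mat m n = {A. idm m * A = A \<and> A * idm n = A}"

lemma Mat_iff_ent: "A \<in> Mat m n \<longleftrightarrow> (\<forall>i j. ent A i j \<noteq> 0 \<longrightarrow> i < m \<and> j < n)"
proof
  assume "A \<in> Mat m n"
  then have "ent (idm m * A) i j = ent A i j" "ent (A * idm n) i j = ent A i j" for i j
    by (auto simp: Mat_def)
  then show "\<forall>i j. ent A i j \<noteq> 0 \<longrightarrow> i < m \<and> j < n"
    unfolding ent_band_mult ent_mult_idm by (metis mult_1)
next
  assume *: "\<forall>i j. ent A i j \<noteq> 0 \<longrightarrow> i < m \<and> j < n"
  have "idm m * A = A" by (rule fsmat_eqI) (use * in \<open>auto simp: ent_band_mult\<close>)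
  moreover have "A * idm n = A" by (rule fsmat_eqI) (use * in \<open>auto simp: ent_mult_idm\<close>)
  ultimately show "A \<in> Mat m n" by (simp add: Mat_def)
qed

lemma MatD: "A \<in> Mat m n \<Longrightarrow> idm m * A = A" "A \<in> Mat m n \<Longrightarrow> A * idm n = A"
  by (auto simp: Mat_def)

lemma Mat_mult [intro]: "A \<in> Mat l m \<Longrightarrow> B \<in> Mat m n \<Longrightarrow> A * B \<in> Mat l n"
  by (simp add: Mat_def mult.assoc) (simp flip: mult.assoc)

lemma Mat_add [intro]: "A \<in> Mat m n \<Longrightarrow> B \<in> Mat m n \<Longrightarrow> A + B \<in> Mat m n"
  by (simp add: Mat_def distrib_left distrib_right)

lemma Mat_diff [intro]: "A \<in> Mat m n \<Longrightarrow> B \<in> Mat m n \<Longrightarrow> A - B \<in> Mat m n"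
  by (simp add: Mat_def left_diff_distrib right_diff_distrib)

lemma Mat_mono: "A \<in> Mat m n \<Longrightarrow> m \<le> m' \<Longrightarrow> n \<le> n' \<Longrightarrow> A \<in> Mat m' n'"
  unfolding Mat_iff_ent by (meson less_le_trans)

lemma Mat_0 [intro, simp]: "0 \<in> Mat m n"
  by (simp add: Mat_def)

lemma Mat_idm [intro]: "r \<le> m \<Longrightarrow> r \<le> n \<Longrightarrow> idm r \<in> Mat m n"
  by (auto simp: Mat_iff_ent band.rep_eq split: if_splits)

lemma Mat_band [intro]: "k \<le> m \<Longrightarrow> a + k \<le> n \<Longrightarrow> band c a k \<in> Mat m n"
  by (auto simp: Mat_iff_ent band.rep_eq split: if_splits)

lemma Mat_single [intro]: "i < m \<Longrightarrow> j < n \<Longrightarrow> single i j c \<in> Mat m n"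
  by (auto simp: Mat_iff_ent single.rep_eq split: if_splits)

lemma idm_inj [simp]: "(idm m :: 'a :: ring_1 fsmat) = idm n \<longleftrightarrow> m = n"
proof
  assume eq: "(idm m :: 'a fsmat) = idm n"
  have "ent (idm m :: 'a fsmat) i i = ent (idm n) i i" for i using eq by simp
  then have "(if i < m then 1 else 0) = (if i < n then 1 else 0 :: 'a)" for i
    by (simp add: band.rep_eq)
  then have "i < m \<longleftrightarrow> i < n" for i by (metis zero_neq_one)
  then show "m = n" by (metis linorder_neqE_nat less_irrefl)
qed simp

lemma idm_0 [simp]: "idm 0 = 0"
  by (rule fsmat_eqI) (simp add: band.rep_eq)

text \<open>Carries an equation between products into longer right-associated products.\<close>
lemma assoc_rule: "a * b = c \<Longrightarrow> a * (b * x) = c * x" for a :: "'a :: semigroup_mult"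
  by (metis mult.assoc)

lemma card_columns: "card (Mat a 1 :: 'a :: finite_field fsmat set) = CARD('a) ^ a"
proof -
  let ?f = "\<lambda>v :: 'a fsmat. restrict (\<lambda>i. ent v i 0) {..<a}"
  have "bij_betw ?f (Mat a 1) ({..<a} \<rightarrow>\<^sub>E UNIV)"
  proof (rule bij_betw_imageI)
    show "inj_on ?f (Mat a 1)"
    proof (rule inj_onI, rule fsmat_eqI)
      fix v w :: "'a fsmat" and i j
      assume v: "v \<in> Mat a 1" and w: "w \<in> Mat a 1" and eq: "?f v = ?f w"
      have "ent v i 0 = ent w i 0" if "i < a" using fun_cong[OF eq, of i] that by simp
      then show "ent v i j = ent w i j" using v w unfolding Mat_iff_ent
        by (metis less_one)
    qed
    show "?f ` Mat a 1 = {..<a} \<rightarrow>\<^sub>E UNIV"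
    proof safe
      fix g :: "nat \<Rightarrow> 'a" assume g: "g \<in> {..<a} \<rightarrow>\<^sub>E UNIV"
      define v where "v = Fsmat (\<lambda>i j. if i < a \<and> j = 0 then g i else 0)"
      have "ent v = (\<lambda>i j. if i < a \<and> j = 0 then g i else 0)"
        unfolding v_def by (rule Fsmat_inverse) (auto intro!: exI[of _ "Suc a"])
      then have "v \<in> Mat a 1" "?f v = g"
        using g by (auto simp: Mat_iff_ent fun_eq_iff PiE_def extensional_def)
      then show "g \<in> ?f ` Mat a 1" by blast
    qed (auto split: if_splits)
  qed
  then have "card (Mat a 1 :: 'a fsmat set) = card ({..<a} \<rightarrow>\<^sub>E (UNIV :: 'a set))"
    by (rule bij_betw_same_card)
  then show ?thesis by (simp add: card_PiE)
qed

text \<open>Injectivity of \<open>v \<mapsto> Y v\<close> compares the numbers of column vectors of both lengths.\<close>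
lemma dim_le_if_left_inverse:
  fixes X Y :: "'a :: finite_field fsmat"
  assumes X: "X \<in> Mat a b" and Y: "Y \<in> Mat b a" and XY: "X * Y = idm a"
  shows "a \<le> b"
proof -
  have "card {0, 1 :: 'a} \<le> CARD('a)" by (rule card_mono) auto
  then have gt1: "CARD('a) > 1" by simp
  have "inj_on (\<lambda>v. Y * v) (Mat a 1)"
  proof (rule inj_onI)
    fix v w :: "'a fsmat" assume "v \<in> Mat a 1" "w \<in> Mat a 1" "Y * v = Y * w"
    then show "v = w" using XY by (metis MatD(1) mult.assoc)
  qed
  moreover have "(\<lambda>v. Y * v) ` Mat a 1 \<subseteq> Mat b 1" using Y by auto
  moreover have "finite (Mat b 1 :: 'a fsmat set)"
    using card_columns[of b, where ?'a = 'a] gt1 by (intro card_ge_0_finite) simp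
  ultimately have "card (Mat a 1 :: 'a fsmat set) \<le> card (Mat b 1 :: 'a fsmat set)"
    by (rule card_inj_on_le)
  then show ?thesis using gt1 unfolding card_columns by simp
qed

section \<open>Factorisation and completion of matrices\<close>

lemma assoc_rule3: "a * (b * c) = d \<Longrightarrow> a * (b * (c * x)) = d * x" for a :: "'a :: semigroup_mult"
  by (metis mult.assoc)

lemma idm_idm_assoc [simp]: "idm a * (idm b * x) = idm (min a b) * x" for x :: "'a :: ring_1 fsmat"
  by (rule assoc_rule) simp

lemma single_mult_single:
  "single i j c * (A * single k l d) = single i l (c * ent A j k * d)" for c :: "'a :: ring"
  by (rule fsmat_eqI) (simp add: ent_single_mult ent_mult_single single.rep_eq mult.assoc)

lemma single_add: "single i j c + single i j d = single i j (c + d)" for c :: "'a :: ring"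
  by (rule fsmat_eqI) (simp add: single.rep_eq)

lemma single_0 [simp]: "single i j 0 = 0"
  by (rule fsmat_eqI) (simp add: single.rep_eq)

lemma idm_Suc: "idm (Suc r) = idm r + (single r r 1 :: 'a :: ring_1 fsmat)"
  by (rule fsmat_eqI) (auto simp: single.rep_eq band.rep_eq)

lemma fsmat_nonzero: "A \<noteq> 0 \<Longrightarrow> \<exists>i j. ent A i j \<noteq> 0"
  by (metis ent_0 fsmat_eqI)

lemma obtain_greatest:
  assumes "P (0 :: nat)" "\<And>r. P r \<Longrightarrow> r \<le> b"
  obtains r where "P r" "\<not> P (Suc r)"
proof -
  have "\<exists>r. P r \<and> (\<forall>r'. P r' \<longrightarrow> r' \<le> r)"
    by (rule ex_has_greatest_nat[of P 0 id "Suc b", simplified]) (use assms in \<open>auto simp: less_Suc_eq_le\<close>)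
  then show ?thesis using that by (metis Suc_n_not_le_n)
qed

definition inj_mats :: "nat \<Rightarrow> nat \<Rightarrow> 'a :: ring_1 fsmat set" where
  "inj_mats m r = {B \<in> Mat m r. \<exists>L\<in>Mat r m. L * B = idm r}"

definition surj_mats :: "nat \<Rightarrow> nat \<Rightarrow> 'a :: ring_1 fsmat set" where
  "surj_mats r n = {C \<in> Mat r n. \<exists>Y\<in>Mat n r. C * Y = idm r}"

lemma inj_matsI: "B \<in> Mat m r \<Longrightarrow> L \<in> Mat r m \<Longrightarrow> L * B = idm r \<Longrightarrow> B \<in> inj_mats m r"
  by (auto simp: inj_mats_def)

lemma surj_matsI: "C \<in> Mat r n \<Longrightarrow> Y \<in> Mat n r \<Longrightarrow> C * Y = idm r \<Longrightarrow> C \<in> surj_mats r n"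
  by (auto simp: surj_mats_def)

lemma inj_matsE:
  assumes "B \<in> inj_mats m r"
  obtains L where "B \<in> Mat m r" "L \<in> Mat r m" "L * B = idm r"
  using assms by (auto simp: inj_mats_def)

lemma surj_matsE:
  assumes "C \<in> surj_mats r n"
  obtains Y where "C \<in> Mat r n" "Y \<in> Mat n r" "C * Y = idm r"
  using assms by (auto simp: surj_mats_def)

definition inverses :: "nat \<Rightarrow> 'a :: ring_1 fsmat \<Rightarrow> 'a fsmat \<Rightarrow> bool" where
  "inverses n M N \<longleftrightarrow> M \<in> Mat n n \<and> N \<in> Mat n n \<and> M * N = idm n \<and> N * M = idm n"

lemma inverses_sym: "inverses n M N \<Longrightarrow> inverses n N M"
  by (auto simp: inverses_def)

lemma inj_mats_le: "B \<in> inj_mats m r \<Longrightarrow> r \<le> m" for B :: "'a :: finite_field fsmat"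
  by (elim inj_matsE) (rule dim_le_if_left_inverse)

lemma surj_mats_le: "C \<in> surj_mats r n \<Longrightarrow> r \<le> n" for C :: "'a :: finite_field fsmat"
  by (elim surj_matsE) (rule dim_le_if_left_inverse)

text \<open>
  Take the largest \<open>r\<close> for which some compression \<open>X A Y\<close> is the identity of size \<open>r\<close>. A nonzero
  entry of the residue \<open>A - A Y X A\<close>, which is killed by \<open>X\<close> and \<open>Y\<close>, would enlarge the
  compression; hence \<open>A = (A Y) (X A)\<close>.
\<close>
lemma rank_factorisation:
  fixes A :: "'a :: finite_field fsmat"
  assumes A: "A \<in> Mat m n"
  obtains r B C where "B \<in> inj_mats m r" "C \<in> surj_mats r n" "A = B * C"
proof -
  define P where "P r \<longleftrightarrow> (\<exists>X\<in>Mat r m. \<exists>Y\<in>Mat n r. X * (A * Y) = idm r)" for r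
  have "P 0" unfolding P_def by (auto intro!: bexI[of _ 0])
  moreover have "P r \<Longrightarrow> r \<le> m" for r
    unfolding P_def using A dim_le_if_left_inverse by blast
  ultimately obtain r where r: "P r" "\<not> P (Suc r)" using obtain_greatest by blast
  then obtain X Y where X: "X \<in> Mat r m" and Y: "Y \<in> Mat n r" and XAY: "X * (A * Y) = idm r"
    unfolding P_def by blast
  note e = MatD[OF A] MatD[OF X] MatD[OF Y]
  note rules = e e[THEN assoc_rule] XAY XAY[THEN assoc_rule3]
  define R where "R = A - A * (Y * (X * A))"
  have "R = 0"
  proof (rule ccontr)
    assume "R \<noteq> 0"
    then obtain i j where c: "ent R i j \<noteq> 0" using fsmat_nonzero by blast
    have RM: "R \<in> Mat m n" unfolding R_def using A X Y by blast
    then have ij: "i < m" "j < n" using c by (auto simp: Mat_iff_ent)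
    \<comment> \<open>A new row and column, orthogonal to the old ones and meeting in the chosen entry.\<close>
    define u where "u = single r i (inverse (ent R i j)) * (idm m - A * (Y * X))"
    define w where "w = (idm n - Y * (X * A)) * single j r 1"
    have XR: "X * R = 0" and RY: "R * Y = 0"
      unfolding R_def by (simp_all add: algebra_simps rules)
    have uA: "u * A = single r i (inverse (ent R i j)) * R"
      unfolding u_def R_def by (simp add: algebra_simps rules)
    have Aw: "A * w = R * single j r 1"
      unfolding w_def R_def by (simp add: algebra_simps rules)
    have "u * (A * w) = single r i (inverse (ent R i j)) * ((idm m - A * (Y * X)) * R) * single j r 1"
      unfolding Aw u_def by (simp add: mult.assoc)
    also have "(idm m - A * (Y * X)) * R = R"
      using XR MatD(1)[OF RM] by (simp add: algebra_simps)
    finally have "u * (A * w) = single r r 1"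
      using c by (simp add: mult.assoc single_mult_single)
    moreover have "u * (A * Y) = 0" using uA RY by (metis mult.assoc mult_zero_right)
    moreover have "X * (A * w) = 0" using Aw XR by (metis mult.assoc mult_zero_left)
    ultimately have "(X + u) * (A * (Y + w)) = idm (Suc r)"
      by (simp add: distrib_left distrib_right XAY idm_Suc)
    moreover have "X + u \<in> Mat (Suc r) m"
    proof -
      have "A * (Y * X) \<in> Mat m m" using A X Y by blast
      then show ?thesis unfolding u_def using Mat_mono[OF X, of "Suc r" m] Mat_idm[of m m m] ij
        by (intro Mat_add Mat_mult[of _ "Suc r" m] Mat_diff Mat_single) auto
    qed
    moreover have "Y + w \<in> Mat n (Suc r)"
    proof -
      have "Y * (X * A) \<in> Mat n n" using A X Y by blast
      then show ?thesis unfolding w_def using Mat_mono[OF Y, of n "Suc r"] Mat_idm[of n n n] ij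
        by (intro Mat_add Mat_mult[of "idm n - Y * (X * A)" n n] Mat_diff Mat_single) auto
    qed
    ultimately show False using r(2) unfolding P_def by blast
  qed
  then have "A = (A * Y) * (X * A)" by (simp add: R_def mult.assoc)
  moreover have "A * Y \<in> inj_mats m r" by (rule inj_matsI[OF _ X XAY]) (use A Y in blast)
  moreover have "X * A \<in> surj_mats r n"
    by (rule surj_matsI[OF _ Y]) (use A X XAY in \<open>auto simp: mult.assoc\<close>)
  ultimately show ?thesis using that by blast
qed

lemma shift_mult_idm: "b \<le> a \<Longrightarrow> band c a k * idm b = (0 :: 'a :: ring_1 fsmat)"
  by (rule fsmat_eqI) (auto simp: ent_band_mult band.rep_eq)

text \<open>
  The transpose of \<open>shift a k\<close>, that is, the inclusion of a block of coordinates.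
\<close>
lift_definition coshift :: "nat \<Rightarrow> nat \<Rightarrow> 'a :: ring_1 fsmat" is
  "\<lambda>a k i j. if j < k \<and> i = a + j then 1 else 0"
  subgoal for a k by (rule exI[of _ "a + k"]) auto
  done

lemma coshift_0 [simp]: "coshift 0 k = idm k"
  by (rule fsmat_eqI) (auto simp: coshift.rep_eq band.rep_eq)

lemma ent_coshift_mult:
  "ent (coshift a k * A) i j = (if a \<le> i \<and> i < a + k then ent A (i - a) j else 0)"
  for A :: "'a :: ring_1 fsmat"
proof (cases "a \<le> i \<and> i < a + k")
  case True
  then have "{l. ent (coshift a k :: 'a fsmat) i l \<noteq> 0} = {i - a}" by (auto simp: coshift.rep_eq)
  then show ?thesis using True by (auto simp: times_fsmat.rep_eq coshift.rep_eq)
next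
  case False
  then have *: "{l. ent (coshift a k :: 'a fsmat) i l \<noteq> 0} = {}" by (auto simp: coshift.rep_eq)
  show ?thesis using False unfolding times_fsmat.rep_eq * by auto
qed

lemma Mat_coshift [intro]: "a + k \<le> m \<Longrightarrow> k \<le> n \<Longrightarrow> coshift a k \<in> Mat m n"
  by (auto simp: Mat_iff_ent coshift.rep_eq split: if_splits)

lemma shift_coshift: "shift a k * coshift a k = (idm k :: 'a :: ring_1 fsmat)"
  by (rule fsmat_eqI) (auto simp: ent_band_mult band.rep_eq coshift.rep_eq)

lemma coshift_shift: "coshift a k * shift a k = (idm (a + k) - idm a :: 'a :: ring_1 fsmat)"
  by (rule fsmat_eqI) (auto simp: ent_coshift_mult band.rep_eq coshift.rep_eq)

lemma idm_mult_coshift: "b \<le> a \<Longrightarrow> idm b * coshift a k = (0 :: 'a :: ring_1 fsmat)"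
  by (rule fsmat_eqI) (auto simp: ent_band_mult coshift.rep_eq)

text \<open>
  A left-invertible matrix together with a chosen left inverse \<open>L\<close> completes to an invertible
  one: \<open>idm m - B L\<close> is idempotent, and its two rank factors supply the missing columns and the
  missing rows of the inverse.
\<close>
lemma complete_to_invertible:
  fixes B L :: "'a :: finite_field fsmat"
  assumes B: "B \<in> Mat m r" and L: "L \<in> Mat r m" and LB: "L * B = idm r"
  obtains M N where "inverses m M N" "M * idm r = B" "idm r * N = L"
proof -
  define p where "p = idm m - B * L"
  note e = MatD[OF B] MatD[OF L]
  note rules = e e[THEN assoc_rule] LB LB[THEN assoc_rule]
  have p: "p \<in> Mat m m" unfolding p_def using B L by blast
  obtain k B2 C2 where B2: "B2 \<in> inj_mats m k" and C2: "C2 \<in> surj_mats k m" and pBC: "p = B2 * C2"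
    using rank_factorisation[OF p] .
  obtain L2 where B2M: "B2 \<in> Mat m k" and L2: "L2 \<in> Mat k m" and LB2: "L2 * B2 = idm k"
    using B2 by (rule inj_matsE)
  obtain Y2 where C2M: "C2 \<in> Mat k m" and Y2: "Y2 \<in> Mat m k" and CY2: "C2 * Y2 = idm k"
    using C2 by (rule surj_matsE)
  note e2 = e MatD[OF B2M] MatD[OF C2M]
  have "p * p = p" "p * B = 0" "L * p = 0"
    unfolding p_def by (simp_all add: algebra_simps rules)
  then have "L2 * (B2 * C2) * (B2 * C2) * Y2 = L2 * (B2 * C2) * Y2"
    "L2 * (B2 * C2) * B = 0" "L * (B2 * C2) * Y2 = 0" by (simp_all add: pBC mult.assoc)
  then have CB2: "C2 * B2 = idm k" and CB: "C2 * B = 0" and LB2': "L * B2 = 0"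
    using LB2 CY2 e2 LB2[THEN assoc_rule] by (simp_all add: mult.assoc MatD[OF L] MatD[OF Y2])
  define M where "M = B + B2 * shift r k"
  define N where "N = L + coshift r k * C2"
  have sB: "shift r k * L = 0"
    using shift_mult_idm[of r r 1 k, THEN assoc_rule, of L] by (simp add: rules)
  have Bs: "B * coshift r k = 0"
    using idm_mult_coshift[of r r k] by (metis e(2) mult.assoc mult_zero_right order_refl)
  have NM: "N * M = idm (r + k)"
    unfolding N_def M_def
    by (simp add: algebra_simps rules e2 CB LB2' CB2 CB2[THEN assoc_rule] LB2'[THEN assoc_rule])
       (metis (no_types) MatD(1) Mat_band coshift_shift add.commute diff_add_cancel le_refl)
  have MN: "M * N = idm m"
  proof -
    have "M * N = B * L + B2 * C2"
      unfolding N_def M_def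
      by (simp add: algebra_simps rules e2 sB Bs Bs[THEN assoc_rule]
          shift_coshift[THEN assoc_rule])
    then show ?thesis by (simp add: p_def flip: pBC)
  qed
  have M: "M \<in> Mat m (r + k)" unfolding M_def using B B2M Mat_mono[OF B, of m "r + k"] by auto
  have N: "N \<in> Mat (r + k) m" unfolding N_def using L C2M Mat_mono[OF L, of "r + k" m] by auto
  have "r + k = m"
    using dim_le_if_left_inverse[OF M N MN] dim_le_if_left_inverse[OF N M NM] by simp
  then have "inverses m M N" using M N MN NM by (auto simp: inverses_def)
  moreover have "M * idm r = B"
    unfolding M_def by (simp add: distrib_right rules mult.assoc shift_mult_idm)
  moreover have "idm r * N = L"
    unfolding N_def
    by (simp add: distrib_left rules idm_mult_coshift[THEN assoc_rule])
  ultimately show ?thesis using that by blast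
qed

section \<open>Adjoints, hermitian forms and Witt's theorem\<close>

lift_definition adj :: "nat \<Rightarrow> 'a :: semiring_1 fsmat \<Rightarrow> 'a fsmat" is
  "\<lambda>q f i j. if f j i = 0 then 0 else f j i ^ q"
  by (metis (lifting))

context unitary_field
begin

abbreviation ct :: "'a fsmat \<Rightarrow> 'a fsmat" ("_\<^sup>\<dagger>" [1000] 999) where
  "A\<^sup>\<dagger> \<equiv> adj q A"

lemma ent_ct: "ent (A\<^sup>\<dagger>) i j = ent A j i ^ q"
  by (simp add: adj.rep_eq)

lemma ct_ct [simp]: "(A\<^sup>\<dagger>)\<^sup>\<dagger> = A"
  by (rule fsmat_eqI) (simp add: ent_ct frobenius_twice)

lemma ct_add [simp]: "(A + B)\<^sup>\<dagger> = A\<^sup>\<dagger> + B\<^sup>\<dagger>"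
  by (rule fsmat_eqI) (simp add: ent_ct frobenius_add)

lemma ct_minus [simp]: "(- A)\<^sup>\<dagger> = - A\<^sup>\<dagger>"
  by (rule fsmat_eqI) (simp add: ent_ct frobenius_minus)

lemma ct_diff [simp]: "(A - B)\<^sup>\<dagger> = A\<^sup>\<dagger> - B\<^sup>\<dagger>"
  using ct_add[of A "- B"] by (simp del: ct_add)

lemma ct_0 [simp]: "0\<^sup>\<dagger> = 0"
  by (rule fsmat_eqI) (simp add: ent_ct)

lemma ct_idm [simp]: "(idm n)\<^sup>\<dagger> = idm n"
  by (rule fsmat_eqI) (auto simp: ent_ct band.rep_eq)

lemma ct_shift [simp]: "(shift a k)\<^sup>\<dagger> = coshift a k"
  by (rule fsmat_eqI) (auto simp: ent_ct band.rep_eq coshift.rep_eq)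

lemma ct_coshift [simp]: "(coshift a k)\<^sup>\<dagger> = shift a k"
  by (rule fsmat_eqI) (auto simp: ent_ct band.rep_eq coshift.rep_eq)

lemma ct_band_0: "(band c 0 k)\<^sup>\<dagger> = band (c ^ q) 0 k"
  by (rule fsmat_eqI) (auto simp: ent_ct band.rep_eq)

lemma ct_single [simp]: "(single i j c)\<^sup>\<dagger> = single j i (c ^ q)"
  by (rule fsmat_eqI) (auto simp: ent_ct single.rep_eq)

lemma ct_mult [simp]: "(A * B)\<^sup>\<dagger> = B\<^sup>\<dagger> * A\<^sup>\<dagger>"
proof (rule fsmat_eqI)
  fix i j
  obtain N M where N: "\<forall>i j. ent A i j \<noteq> 0 \<longrightarrow> i < N \<and> j < N"
    and M: "\<forall>i j. ent B i j \<noteq> 0 \<longrightarrow> i < M \<and> j < M"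
    using fsmat_bound by meson
  define K where "K = max N M"
  have A: "ent (A * B) j i = (\<Sum>k<K. ent A j k * ent B k i)"
    by (rule ent_mult_bound) (use N K_def in \<open>auto simp: less_max_iff_disj\<close>)
  have "ent (B\<^sup>\<dagger> * A\<^sup>\<dagger>) i j = (\<Sum>k<K. ent (B\<^sup>\<dagger>) i k * ent (A\<^sup>\<dagger>) k j)"
    by (rule ent_mult_bound) (use M in \<open>auto simp: less_max_iff_disj ent_ct K_def\<close>)
  then show "ent ((A * B)\<^sup>\<dagger>) i j = ent (B\<^sup>\<dagger> * A\<^sup>\<dagger>) i j"
    by (simp add: ent_ct A frobenius_sum power_mult_distrib mult.commute)
qed

lemma ct_eq_iff [simp]: "A\<^sup>\<dagger> = B\<^sup>\<dagger> \<longleftrightarrow> A = B"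
  by (metis ct_ct)

lemma Mat_ct [intro]: "A \<in> Mat m n \<Longrightarrow> A\<^sup>\<dagger> \<in> Mat n m"
  by (auto simp: Mat_iff_ent ent_ct)

lemma ct_eqD: "X * Y = Z \<Longrightarrow> Y\<^sup>\<dagger> * X\<^sup>\<dagger> = Z\<^sup>\<dagger>"
  by (metis ct_mult)

lemma ct_inj_mats: "B\<^sup>\<dagger> \<in> surj_mats r m \<longleftrightarrow> B \<in> inj_mats m r"
proof
  assume "B\<^sup>\<dagger> \<in> surj_mats r m"
  then obtain Y where "B\<^sup>\<dagger> \<in> Mat r m" "Y \<in> Mat m r" "B\<^sup>\<dagger> * Y = idm r" by (rule surj_matsE)
  then show "B \<in> inj_mats m r"
    using ct_eqD[of "B\<^sup>\<dagger>" Y "idm r"] Mat_ct[of "B\<^sup>\<dagger>" r m] by (intro inj_matsI[of _ _ _ "Y\<^sup>\<dagger>"]) auto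
next
  assume "B \<in> inj_mats m r"
  then obtain L where "B \<in> Mat m r" "L \<in> Mat r m" "L * B = idm r" by (rule inj_matsE)
  then show "B\<^sup>\<dagger> \<in> surj_mats r m"
    using ct_eqD[of L B "idm r"] by (intro surj_matsI[of _ _ _ "L\<^sup>\<dagger>"]) auto
qed

lemma ct_surj_mats: "C\<^sup>\<dagger> \<in> inj_mats n r \<longleftrightarrow> C \<in> surj_mats r n"
  using ct_inj_mats[of "C\<^sup>\<dagger>" r n] by simp

text \<open>
  A nonzero hermitian form represents 1: along a coordinate vector with nonzero value because
  the norm is surjective, and otherwise in a plane spanned by two isotropic coordinate vectors
  because the trace is surjective.
\<close>
lemma hermitian_represents_1:
  assumes G: "G \<in> Mat r r" and herm: "G\<^sup>\<dagger> = G" and nz: "G \<noteq> 0"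
  obtains v where "v \<in> Mat r 1" "v\<^sup>\<dagger> * (G * v) = idm 1"
proof -
  have Gij: "ent G j i = ent G i j ^ q" for i j
    by (metis ent_ct herm)
  have one: "idm 1 = single 0 0 (1 :: 'a)" by (simp add: idm_Suc)
  show ?thesis
  proof (cases "\<exists>i. ent G i i \<noteq> 0")
    case True
    then obtain i where i: "ent G i i \<noteq> 0" by blast
    then have ir: "i < r" using G by (auto simp: Mat_iff_ent)
    have "inverse (ent G i i) ^ q = inverse (ent G i i)"
      using Gij[of i i] by (metis power_inverse)
    then obtain a where "a * a ^ q = inverse (ent G i i)"
      using norm_surj[of "inverse (ent G i i)"] i by auto
    then have "a ^ q * ent G i i * a = 1" using i by (simp add: field_simps)
    then have "(single i 0 a)\<^sup>\<dagger> * (G * single i 0 a) = idm 1"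
      unfolding one by (simp add: single_mult_single)
    then show ?thesis using that ir by blast
  next
    case False
    then have diag: "ent G i i = 0" for i by simp
    obtain i j where c: "ent G i j \<noteq> 0" using nz fsmat_nonzero by blast
    then have ij: "i < r" "j < r" using G by (auto simp: Mat_iff_ent)
    obtain y :: 'a where y: "y + y ^ q = 1" using trace_surj[of 1] by auto
    \<comment> \<open>On \<open>a e\<^sub>i + e\<^sub>j\<close> the form takes the trace of \<open>a\<^sup>q\<close> times the entry, which is \<open>y + y\<^sup>q\<close>.\<close>
    define a where "a = (y / ent G i j) ^ q"
    have a: "a ^ q * ent G i j = y" "ent G j i * a = y ^ q"
      using c by (simp_all add: a_def frobenius_twice Gij[of i j] power_divide)
    define v where "v = single i 0 a + single j 0 1"
    have "v\<^sup>\<dagger> * (G * v) = single 0 0 (a ^ q * ent G i i * a) + single 0 0 (a ^ q * ent G i j) +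
        (single 0 0 (ent G j i * a) + single 0 0 (ent G j j))"
      unfolding v_def by (simp add: distrib_left distrib_right single_mult_single add_ac)
    also have "\<dots> = idm 1"
      unfolding one using a diag y by (simp add: single_add)
    finally show ?thesis using that[of v] ij by (auto simp: v_def)
  qed
qed

text \<open>
  Over a finite field a hermitian form is determined by its rank. The argument is that of
  rank factorisation, with a maximal orthonormal family in place of a maximal compression.
\<close>
lemma hermitian_factorisation:
  assumes G: "G \<in> Mat r r" and herm: "G\<^sup>\<dagger> = G"
  obtains t D where "D \<in> surj_mats t r" "G = D\<^sup>\<dagger> * D"
proof -
  define P where "P t \<longleftrightarrow> (\<exists>X\<in>Mat r t. X\<^sup>\<dagger> * (G * X) = idm t)" for t
  have "P 0" unfolding P_def by (auto intro!: bexI[of _ 0])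
  moreover have "P t \<Longrightarrow> t \<le> r" for t
    unfolding P_def using G dim_le_if_left_inverse by blast
  ultimately obtain t where t: "P t" "\<not> P (Suc t)" using obtain_greatest by blast
  then obtain X where X: "X \<in> Mat r t" and XGX: "X\<^sup>\<dagger> * (G * X) = idm t" unfolding P_def by blast
  have Xc: "X\<^sup>\<dagger> \<in> Mat t r" using X by blast
  note e = MatD[OF G] MatD[OF X] MatD[OF Xc]
  note rules = e e[THEN assoc_rule] XGX XGX[THEN assoc_rule3]
  define R where "R = G - G * (X * (X\<^sup>\<dagger> * G))"
  have "R = 0"
  proof (rule ccontr)
    assume nz: "R \<noteq> 0"
    have XR: "X\<^sup>\<dagger> * R = 0" and RX: "R * X = 0"
      unfolding R_def by (simp_all add: algebra_simps rules)
    have RM: "R \<in> Mat r r" unfolding R_def using G X Xc by blast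
    have "R\<^sup>\<dagger> = R" unfolding R_def by (simp add: herm mult.assoc)
    then obtain v where v: "v \<in> Mat r 1" and vRv: "v\<^sup>\<dagger> * (R * v) = idm 1"
      using hermitian_represents_1[OF RM] nz by blast
    \<comment> \<open>The projection of \<open>v\<close> to the complement of the columns of \<open>X\<close>, put into column \<open>t\<close>.\<close>
    define w where "w = (idm r - X * (X\<^sup>\<dagger> * G)) * (v * single 0 t 1)"
    have Gw: "G * w = R * (v * single 0 t 1)"
      unfolding w_def R_def by (simp add: algebra_simps rules)
    have XGw: "X\<^sup>\<dagger> * (G * w) = 0" unfolding Gw using XR by (metis mult.assoc mult_zero_left)
    have wGX: "w\<^sup>\<dagger> * (G * X) = 0"
      using arg_cong[OF XGw, of "adj q"] by (simp add: herm mult.assoc)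
    have "w\<^sup>\<dagger> * (G * w) = single t 0 1 * (v\<^sup>\<dagger> * ((idm r - G * (X * X\<^sup>\<dagger>)) * R) * (v * single 0 t 1))"
      unfolding Gw unfolding w_def by (simp add: herm mult.assoc)
    also have "(idm r - G * (X * X\<^sup>\<dagger>)) * R = R"
      using XR MatD(1)[OF RM] by (simp add: algebra_simps)
    also have "single t 0 1 * (v\<^sup>\<dagger> * R * (v * single 0 t 1)) = single t t 1"
      using vRv by (simp add: mult.assoc assoc_rule3[OF vRv] single_mult_single band.rep_eq)
    finally have "(X + w)\<^sup>\<dagger> * (G * (X + w)) = idm (Suc t)"
      by (simp add: distrib_left distrib_right XGX XGw wGX idm_Suc)
    moreover have "X + w \<in> Mat r (Suc t)"
    proof -
      have "X * (X\<^sup>\<dagger> * G) \<in> Mat r r" using X Xc G by blast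
      then have "idm r - X * (X\<^sup>\<dagger> * G) \<in> Mat r r" by (intro Mat_diff) auto
      moreover have "v * single 0 t 1 \<in> Mat r (Suc t)" using v by (rule Mat_mult) auto
      ultimately show ?thesis unfolding w_def using Mat_mono[OF X, of r "Suc t"] by auto
    qed
    ultimately show False using t(2) unfolding P_def by blast
  qed
  then have "G = (X\<^sup>\<dagger> * G)\<^sup>\<dagger> * (X\<^sup>\<dagger> * G)" by (simp add: R_def herm mult.assoc)
  moreover have "X\<^sup>\<dagger> * G \<in> surj_mats t r"
    by (rule surj_matsI[OF _ X]) (use Xc G XGX in \<open>auto simp: mult.assoc\<close>)
  ultimately show ?thesis using that by blast
qed

text \<open>
  The nondegenerate quotient of a hermitian space is unique up to isometry: \<open>D' Y\<close>, for a right
  inverse \<open>Y\<close> of \<open>D\<close>, is the isometry between two models of it.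
\<close>
lemma hermitian_factorisation_unique:
  assumes D: "D \<in> surj_mats t r" and D': "D' \<in> surj_mats t' r"
    and eq: "D\<^sup>\<dagger> * D = D'\<^sup>\<dagger> * D'"
  obtains Z where "Z \<in> Mat t t" "Z\<^sup>\<dagger> * Z = idm t" "D' = Z * D" "t' = t"
proof -
  obtain Y where Dm: "D \<in> Mat t r" and Y: "Y \<in> Mat r t" and DY: "D * Y = idm t"
    using D by (rule surj_matsE)
  obtain Y' where Dm': "D' \<in> Mat t' r" and Y': "Y' \<in> Mat r t'" and DY': "D' * Y' = idm t'"
    using D' by (rule surj_matsE)
  note YD = ct_eqD[OF DY, simplified] and YD' = ct_eqD[OF DY', simplified]
  have Y'D: "D' = (Y'\<^sup>\<dagger> * D\<^sup>\<dagger>) * D"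
    using arg_cong[OF eq, of "\<lambda>x. Y'\<^sup>\<dagger> * x"] by (simp add: mult.assoc assoc_rule[OF YD'] MatD[OF Dm'])
  then have "D' * Y = Y'\<^sup>\<dagger> * D\<^sup>\<dagger>"
    by (metis DY Dm Mat_ct MatD(2) mult.assoc)
  then have Z: "D' = (D' * Y) * D" using Y'D by simp
  have ZZ: "(D' * Y)\<^sup>\<dagger> * (D' * Y) = idm t"
    using arg_cong[OF eq, of "\<lambda>x. Y\<^sup>\<dagger> * x * Y"] DY
    by (simp add: mult.assoc assoc_rule[OF YD] MatD[OF Dm])
  have "t \<le> t'" using ZZ Dm Dm' Y by (intro dim_le_if_left_inverse[of "(D' * Y)\<^sup>\<dagger>" t t' "D' * Y"]) auto
  moreover have "(D' * Y) * (D * Y') = idm t'"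
    using DY' Z by (metis mult.assoc)
  then have "t' \<le> t" using Dm Dm' Y Y' by (intro dim_le_if_left_inverse[of "D' * Y" t' t "D * Y'"]) auto
  ultimately have "t' = t" by simp
  then show ?thesis using that[of "D' * Y"] Z ZZ Dm' Y by auto
qed

text \<open>The completion of a square matrix is that matrix itself.\<close>
lemma square_inverse:
  fixes X Y :: "'a fsmat"
  assumes "X \<in> Mat m m" "Y \<in> Mat m m" "X * Y = idm m"
  shows "inverses m X Y"
proof -
  obtain M N where MN: "inverses m M N" "M * idm m = Y" "idm m * N = X"
    using complete_to_invertible[OF assms(2,1,3)] .
  then have "M = Y" "N = X" by (auto simp: inverses_def MatD)
  then show ?thesis using MN(1) inverses_sym by blast
qed

text \<open>
  The orthogonal complement of a nondegenerate subspace has an orthonormal basis: factor the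
  orthogonal projection \<open>p\<close>, which is hermitian, as \<open>D\<^sup>\<dagger> D\<close>; idempotency of \<open>p\<close> says
  \<open>D D\<^sup>\<dagger> = 1\<close>. Bases with the same nondegenerate Gram matrix therefore extend to bases of the
  whole space with the same Gram matrix.
\<close>
lemma orthogonal_completion:
  assumes B: "B \<in> Mat m d" and J: "J \<in> Mat d d"
    and BB: "B\<^sup>\<dagger> * B = J" and JJ: "J * J = idm d"
  obtains M N where "inverses m M N" "M * idm d = B" "M\<^sup>\<dagger> * M = J + (idm m - idm d)" "d \<le> m"
proof -
  have Bc: "B\<^sup>\<dagger> \<in> Mat d m" using B by blast
  have Jc: "J\<^sup>\<dagger> = J" using BB by (metis ct_ct ct_mult)
  note e = MatD[OF B] MatD[OF Bc] MatD[OF J]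
  note rules = e e[THEN assoc_rule] BB BB[THEN assoc_rule] JJ JJ[THEN assoc_rule]
  define p where "p = idm m - B * (J * B\<^sup>\<dagger>)"
  have p: "p \<in> Mat m m" "p\<^sup>\<dagger> = p"
    unfolding p_def using B Bc J by (auto simp: Jc mult.assoc)
  obtain k D where D: "D \<in> surj_mats k m" and pD: "p = D\<^sup>\<dagger> * D"
    using hermitian_factorisation[OF p] .
  then obtain Y where Dm: "D \<in> Mat k m" and Y: "Y \<in> Mat m k" and DY: "D * Y = idm k"
    by (elim surj_matsE)
  have Dc: "D\<^sup>\<dagger> \<in> Mat m k" using Dm by blast
  note YD = ct_eqD[OF DY, simplified]
  note e2 = MatD[OF Dm] MatD[OF Dc]
  note rules2 = e2 e2[THEN assoc_rule] DY DY[THEN assoc_rule] YD YD[THEN assoc_rule]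
  have pp: "p * p = p" and pB: "p * B = 0"
    unfolding p_def by (simp_all add: algebra_simps rules)
  have DD: "D * D\<^sup>\<dagger> = idm k"
    using arg_cong[OF pp, of "\<lambda>x. Y\<^sup>\<dagger> * x * Y"] unfolding pD by (simp add: mult.assoc rules2)
  have DB: "D * B = 0"
    using arg_cong[OF pB, of "\<lambda>x. Y\<^sup>\<dagger> * x"] unfolding pD by (simp add: mult.assoc rules2)
  have BD: "B\<^sup>\<dagger> * D\<^sup>\<dagger> = 0" using ct_eqD[OF DB] by simp
  note rules3 = rules rules2 DD DD[THEN assoc_rule] DB DB[THEN assoc_rule] BD BD[THEN assoc_rule]
  define M where "M = B + D\<^sup>\<dagger> * shift d k"
  define N where "N = J * B\<^sup>\<dagger> + coshift d k * D"
  have sJ: "shift d k * J = 0" and sB: "shift d k * B\<^sup>\<dagger> = 0"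
    using shift_mult_idm[of d d 1 k, THEN assoc_rule] e by (metis mult_zero_left order_refl)+
  have Bs: "B * coshift d k = 0" and Js: "J * coshift d k = 0"
    using idm_mult_coshift[of d d k] e by (metis mult.assoc mult_zero_right order_refl)+
  note rules4 = rules3 sJ sB Bs Js sJ[THEN assoc_rule] sB[THEN assoc_rule] Bs[THEN assoc_rule]
    Js[THEN assoc_rule] shift_coshift shift_coshift[THEN assoc_rule] coshift_shift
  have cs: "coshift d k * (idm k * shift d k) = idm (d + k) - idm d"
    by (metis MatD(1) Mat_band coshift_shift order_refl)
  have MN: "M * N = idm m"
  proof -
    have "M * N = B * (J * B\<^sup>\<dagger>) + D\<^sup>\<dagger> * D"
      unfolding M_def N_def by (simp add: algebra_simps rules4)
    then show ?thesis by (simp add: p_def flip: pD)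
  qed
  have NM: "N * M = idm (d + k)"
    unfolding M_def N_def by (simp add: algebra_simps rules4 cs)
  have M: "M \<in> Mat m (d + k)" unfolding M_def using Dc Mat_mono[OF B, of m "d + k"] by auto
  have N: "N \<in> Mat (d + k) m" unfolding N_def
    using J Bc Dm Mat_mono[of "J * B\<^sup>\<dagger>" d m "d + k" m] by auto
  have "d + k = m"
    using dim_le_if_left_inverse[OF M N MN] dim_le_if_left_inverse[OF N M NM] by simp
  then have "inverses m M N" "d \<le> m" using M N MN NM by (auto simp: inverses_def)
  moreover have "M * idm d = B"
    unfolding M_def by (simp add: distrib_right rules mult.assoc shift_mult_idm)
  moreover have "M\<^sup>\<dagger> * M = J + (idm m - idm d)"
    unfolding M_def using \<open>d + k = m\<close> by (simp add: algebra_simps rules4 cs)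
  ultimately show ?thesis using that by blast
qed

text \<open>Split the diagonal by surjectivity of the trace; the rest of \<open>K\<close> is the upper triangle.\<close>
lemma hermitian_is_trace:
  assumes H: "H \<in> Mat k k" and herm: "H\<^sup>\<dagger> = H"
  obtains K where "K \<in> Mat k k" "K + K\<^sup>\<dagger> = H"
proof -
  have Hij: "ent H j i = ent H i j ^ q" for i j
    by (metis ent_ct herm)
  have "\<forall>i. \<exists>a. a + a ^ q = ent H i i" using trace_surj Hij by metis
  then obtain a where a: "\<And>i. a i + a i ^ q = ent H i i" by metis
  define K where "K = Fsmat (\<lambda>i j. if i < k \<and> j < k
    then (if i = j then a i else if i < j then ent H i j else 0) else 0)"
  have K: "ent K = (\<lambda>i j. if i < k \<and> j < k
    then (if i = j then a i else if i < j then ent H i j else 0) else 0)"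
    unfolding K_def by (rule Fsmat_inverse) (auto intro!: exI[of _ k])
  have "K + K\<^sup>\<dagger> = H"
  proof (rule fsmat_eqI)
    fix i j
    show "ent (K + K\<^sup>\<dagger>) i j = ent H i j"
    proof (cases "i < k \<and> j < k")
      case True
      then show ?thesis using a[of i] Hij[of i j] Hij[of j i]
        by (cases i j rule: linorder_cases) (auto simp: ent_ct K)
    next
      case False
      then have "ent H i j = 0" using H by (auto simp: Mat_iff_ent)
      then show ?thesis using False by (auto simp: ent_ct K)
    qed
  qed
  moreover have "K \<in> Mat k k" by (auto simp: Mat_iff_ent K split: if_splits)
  ultimately show ?thesis using that by blast
qed

definition unitary :: "nat \<Rightarrow> 'a fsmat \<Rightarrow> bool" where
  "unitary m X \<longleftrightarrow> X \<in> Mat m m \<and> X * X\<^sup>\<dagger> = idm m"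

lemma unitaryD:
  assumes "unitary m X"
  shows "X \<in> Mat m m" "X * X\<^sup>\<dagger> = idm m" "X\<^sup>\<dagger> * X = idm m"
  using assms square_inverse[of X m "X\<^sup>\<dagger>"] by (auto simp: unitary_def inverses_def)

lemma unitaryI: "X \<in> Mat m m \<Longrightarrow> X\<^sup>\<dagger> * X = idm m \<Longrightarrow> unitary m X"
  using square_inverse[OF Mat_ct, of X m X] by (simp add: unitary_def inverses_def)

lemma unitary_ct: "unitary m X \<Longrightarrow> unitary m (X\<^sup>\<dagger>)"
  by (metis Mat_ct ct_ct unitary_def unitaryD(3))

lemma unitary_idm: "unitary m (idm m)"
  by (auto simp: unitary_def)

text \<open>
  A basis \<open>B\<close> of a subspace whose Gram matrix is \<open>diag(1, 0)\<close> is part of a basis of the whole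
  space whose Gram matrix depends on the dimensions only. The \<open>r - t\<close> radical vectors are
  completed to hyperbolic pairs: a dual family \<open>S0\<close> exists because \<open>B\<close> is injective, and it
  becomes isotropic after subtracting from it radical vectors with coefficients \<open>K\<close>, where
  \<open>K + K\<^sup>\<dagger>\<close> is its Gram matrix. What is then spanned is nondegenerate.
\<close>
lemma adapted_frame:
  assumes B: "B \<in> inj_mats m r" and BB: "B\<^sup>\<dagger> * B = idm t" and tr: "t \<le> r"
  obtains M N where "inverses m M N" "M * idm r = B"
    "M\<^sup>\<dagger> * M = idm t + coshift t (r - t) * shift r (r - t) + coshift r (r - t) * shift t (r - t)
       + (idm m - idm (2 * r - t))"
    "2 * r \<le> m + t"
proof -
  define k where "k = r - t"
  have tk: "t + k = r" using tr by (simp add: k_def)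
  obtain L where Bm: "B \<in> Mat m r" and L: "L \<in> Mat r m" and LB: "L * B = idm r"
    using B by (rule inj_matsE)
  define j where "j = (coshift t k :: 'a fsmat)"
  have j: "j \<in> Mat r k" "j\<^sup>\<dagger> * j = idm k" "idm t * j = 0" "j\<^sup>\<dagger> = shift t k"
    "shift t k * j = idm k" "j * shift t k = idm r - idm t"
    using tk unfolding j_def
    by (auto simp: shift_coshift idm_mult_coshift coshift_shift)
  define S0 where "S0 = L\<^sup>\<dagger> * j"
  have S0: "S0 \<in> Mat m k" unfolding S0_def using L j by blast
  have BS0: "B\<^sup>\<dagger> * S0 = j"
    unfolding S0_def using assoc_rule[OF ct_eqD[OF LB, simplified]] j MatD by simp
  have S0B: "S0\<^sup>\<dagger> * B = shift t k" using ct_eqD[OF BS0] j by simp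
  have "(S0\<^sup>\<dagger> * S0)\<^sup>\<dagger> = S0\<^sup>\<dagger> * S0" by simp
  moreover have "S0\<^sup>\<dagger> * S0 \<in> Mat k k" using S0 by blast
  ultimately obtain K where K: "K \<in> Mat k k" and KK: "K + K\<^sup>\<dagger> = S0\<^sup>\<dagger> * S0"
    using hermitian_is_trace by blast
  have Kc: "K\<^sup>\<dagger> \<in> Mat k k" using K by blast
  note rules = BB BB[THEN assoc_rule] BS0 BS0[THEN assoc_rule] S0B S0B[THEN assoc_rule]
    j(2-) j(2,3,5,6)[THEN assoc_rule] MatD[OF K] MatD[OF Kc]
  define S where "S = S0 - B * (j * K)"
  have S: "S \<in> Mat m k" unfolding S_def using S0 Bm j K by blast
  have "S\<^sup>\<dagger> * S = S0\<^sup>\<dagger> * S0 - (K + K\<^sup>\<dagger>)"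
    unfolding S_def by (simp add: algebra_simps rules)
  then have SS: "S\<^sup>\<dagger> * S = 0" by (simp add: KK)
  have BS: "B\<^sup>\<dagger> * S = j" unfolding S_def by (simp add: algebra_simps rules)
  have SB: "S\<^sup>\<dagger> * B = shift t k" using ct_eqD[OF BS] j by simp
  define J where "J = idm t + (j * shift r k + coshift r k * shift t k :: 'a fsmat)"
  define B1 where "B1 = B + S * shift r k"
  have B1: "B1 \<in> Mat m (r + k)" unfolding B1_def using S Mat_mono[OF Bm, of m "r + k"] by auto
  have J: "J \<in> Mat (r + k) (r + k)" unfolding J_def
    using tk Mat_mono[OF j(1), of "r + k" k] by (intro Mat_add Mat_mult[of _ "r + k" k]) auto
  have BB1: "B1\<^sup>\<dagger> * B1 = J"
    unfolding B1_def J_def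
    by (simp add: algebra_simps rules SS BS SB SS[THEN assoc_rule] BS[THEN assoc_rule]
        SB[THEN assoc_rule])
  have z1: "shift r k * j = 0" "shift t k * coshift r k = (0 :: 'a fsmat)"
    using tk unfolding j_def
    by (auto intro!: fsmat_eqI simp: ent_band_mult coshift.rep_eq)
  have z2: "shift r k * idm t = (0 :: 'a fsmat)" "idm t * coshift r k = (0 :: 'a fsmat)"
    "shift t k * idm t = (0 :: 'a fsmat)"
    using tk by (auto simp: shift_mult_idm idm_mult_coshift)
  have z3: "idm k * shift r k = (shift r k :: 'a fsmat)" "idm k * shift t k = (shift t k :: 'a fsmat)"
    by (auto intro!: MatD(1) Mat_band)
  have JJ: "J * J = idm (r + k)"
    unfolding J_def using tk
    by (simp add: algebra_simps z1 z2 z3 z1[THEN assoc_rule] z2[THEN assoc_rule] rules shift_coshift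
        shift_coshift[THEN assoc_rule] coshift_shift)
  obtain M N where MN: "inverses m M N" "M * idm (r + k) = B1"
      "M\<^sup>\<dagger> * M = J + (idm m - idm (r + k))" "r + k \<le> m"
    using orthogonal_completion[OF B1 J BB1 JJ] .
  have "M * idm r = B1 * idm r" by (simp add: MN(2)[symmetric] mult.assoc)
  also have "\<dots> = B" unfolding B1_def
    by (simp add: distrib_right MatD[OF Bm] mult.assoc shift_mult_idm)
  finally have "M * idm r = B" .
  moreover have "r + k = 2 * r - t" "2 * r \<le> m + t" using tk MN(4) by auto
  ultimately show ?thesis using that[OF MN(1)] MN(3) by (simp add: J_def j_def k_def add.assoc)
qed

text \<open>
  Completing the factor \<open>D\<close> of a Gram matrix to an invertible matrix \<open>P\<close> gives coordinates in
  which the form is \<open>diag(1, 0)\<close>.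
\<close>
lemma normalise_gram:
  assumes G: "G \<in> Mat r r" and D: "D \<in> surj_mats t r" and GD: "G = D\<^sup>\<dagger> * D"
  obtains P Q where "inverses r P Q" "Q\<^sup>\<dagger> * (G * Q) = idm t" "D = idm t * P" "t \<le> r"
proof -
  obtain Y where Dm: "D \<in> Mat t r" and Y: "Y \<in> Mat r t" and DY: "D * Y = idm t"
    using D by (rule surj_matsE)
  obtain Q P where QP: "inverses r Q P" "Q * idm t = Y" "idm t * P = D"
    using complete_to_invertible[OF Y Dm DY] .
  have tr: "t \<le> r" using D by (rule surj_mats_le)
  have "D * Q = idm t" using QP tr unfolding QP(3)[symmetric]
    by (simp add: inverses_def mult.assoc min_absorb1)
  then have "Q\<^sup>\<dagger> * (G * Q) = idm t"
    using ct_eqD[of D Q "idm t"] by (simp add: GD mult.assoc)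
       (metis ct_idm idm_idm assoc_rule min.idem)
  then show ?thesis using that inverses_sym[OF QP(1)] QP(3) tr by blast
qed

text \<open>
  Witt's extension theorem for a subspace that may be degenerate. After normalising the common
  Gram matrix, both bases extend to bases of the whole space with one and the same Gram matrix,
  and the change between these is unitary.
\<close>
lemma witt:
  assumes B: "B \<in> inj_mats m r" and B': "B' \<in> inj_mats m r" and eq: "B\<^sup>\<dagger> * B = B'\<^sup>\<dagger> * B'"
  obtains X where "unitary m X" "B' = X * B"
proof -
  obtain L where Bm: "B \<in> Mat m r" and L: "L \<in> Mat r m" and LB: "L * B = idm r"
    using B by (rule inj_matsE)
  obtain L' where Bm': "B' \<in> Mat m r" and L': "L' \<in> Mat r m" and LB': "L' * B' = idm r"
    using B' by (rule inj_matsE)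
  have G: "B\<^sup>\<dagger> * B \<in> Mat r r" using Bm by blast
  obtain t D where D: "D \<in> surj_mats t r" "B\<^sup>\<dagger> * B = D\<^sup>\<dagger> * D"
    using hermitian_factorisation[OF G] by (metis ct_ct ct_mult)
  obtain P Q where PQ: "inverses r P Q" and gram: "Q\<^sup>\<dagger> * (B\<^sup>\<dagger> * B * Q) = idm t" and tr: "t \<le> r"
    using normalise_gram[OF G D] .
  have P: "P \<in> Mat r r" and Q: "Q \<in> Mat r r" and PQ1: "P * Q = idm r" and QP1: "Q * P = idm r"
    using PQ by (auto simp: inverses_def)
  have BQ: "B * Q \<in> inj_mats m r"
    by (rule inj_matsI[of _ _ _ "P * L"]) (use Bm P Q L in \<open>auto simp: mult.assoc assoc_rule[OF LB] MatD PQ1\<close>)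
  have BQ': "B' * Q \<in> inj_mats m r"
    by (rule inj_matsI[of _ _ _ "P * L'"]) (use Bm' P Q L' in \<open>auto simp: mult.assoc assoc_rule[OF LB'] MatD PQ1\<close>)
  have g: "(B * Q)\<^sup>\<dagger> * (B * Q) = idm t" using gram by (simp add: mult.assoc)
  have g': "(B' * Q)\<^sup>\<dagger> * (B' * Q) = idm t" using gram unfolding eq by (simp add: mult.assoc)
  obtain M N where MN: "inverses m M N" "M * idm r = B * Q"
    "M\<^sup>\<dagger> * M = idm t + coshift t (r - t) * shift r (r - t) + coshift r (r - t) * shift t (r - t)
       + (idm m - idm (2 * r - t))" using adapted_frame[OF BQ g tr] .
  obtain M' N' where MN': "inverses m M' N'" "M' * idm r = B' * Q"
    "M'\<^sup>\<dagger> * M' = idm t + coshift t (r - t) * shift r (r - t) + coshift r (r - t) * shift t (r - t)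
       + (idm m - idm (2 * r - t))" using adapted_frame[OF BQ' g' tr] .
  have MM: "M'\<^sup>\<dagger> * M' = M\<^sup>\<dagger> * M" using MN(3) MN'(3) by simp
  have M: "M \<in> Mat m m" "N \<in> Mat m m" "M * N = idm m" "N * M = idm m" "M' \<in> Mat m m"
    using MN(1) MN'(1) by (auto simp: inverses_def)
  define X where "X = M' * N"
  have X: "X \<in> Mat m m" unfolding X_def using M by blast
  have "X\<^sup>\<dagger> * X = N\<^sup>\<dagger> * (M\<^sup>\<dagger> * M) * N" unfolding X_def by (simp add: mult.assoc flip: MM)
  also have "\<dots> = (M * N)\<^sup>\<dagger> * (M * N)" by (simp add: mult.assoc)
  finally have "X\<^sup>\<dagger> * X = idm m" by (simp add: M)
  then have "unitary m X" using X by (intro unitaryI)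
  moreover have "B' = X * B"
  proof -
    have "X * (B * Q) = M' * (N * M) * idm r" unfolding X_def MN(2)[symmetric] by (simp add: mult.assoc)
    also have "\<dots> = B' * Q" using M MN'(2) by (simp add: MatD)
    finally have "X * B * (Q * P) = B' * (Q * P)" by (metis mult.assoc)
    then show ?thesis using Bm Bm' unfolding QP1 by (metis MatD(2) mult.assoc)
  qed
  ultimately show ?thesis using that by blast
qed

end

section \<open>Factorisations through an intermediate space\<close>

text \<open>
  The inner factors of a product of rank \<open>\<rho>\<close> have a normal form that depends on the dimensions
  only. The basis \<open>M\<close> of the middle space starts with a section \<open>X'\<close> of \<open>D\<close> that extends
  the first \<open>\<rho>\<close> columns of \<open>Y\<close>, followed by the other columns \<open>Z\<close> of \<open>Y\<close>, which \<open>D\<close> kills.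
\<close>
lemma factorisation_frame:
  fixes D Y :: "'a :: finite_field fsmat"
  assumes D: "D \<in> surj_mats s r" and Y: "Y \<in> inj_mats r t"
    and DY: "D * Y = idm \<rho>" and le: "\<rho> \<le> s" "\<rho> \<le> t"
  obtains M N where "inverses r M N" "D * M = idm s"
    "M * (idm \<rho> + coshift s (t - \<rho>) * shift \<rho> (t - \<rho>)) = Y" "s + t \<le> r + \<rho>"
proof -
  define k where "k = t - \<rho>"
  have k: "\<rho> + k = t" using le by (simp add: k_def)
  obtain X where Dm: "D \<in> Mat s r" and X: "X \<in> Mat r s" and DX: "D * X = idm s"
    using D by (rule surj_matsE)
  obtain L where Ym: "Y \<in> Mat r t" and L: "L \<in> Mat t r" and LY: "L * Y = idm t"
    using Y by (rule inj_matsE)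
  note e = MatD[OF Dm] MatD[OF X] MatD[OF Ym] MatD[OF L]
  note rules = e e[THEN assoc_rule] DX DX[THEN assoc_rule] DY DY[THEN assoc_rule] LY
    LY[THEN assoc_rule]
  define X' where "X' = Y * idm \<rho> + X * (idm s - idm \<rho>)"
  define Z where "Z = Y * coshift \<rho> k"
  define L' where "L' = shift \<rho> k * (L * (idm r - X' * D))"
  have X': "X' \<in> Mat r s" unfolding X'_def using X Ym le by (auto intro!: Mat_add Mat_mult)
  have Z: "Z \<in> Mat r k" unfolding Z_def using Ym k by auto
  have XDm: "X' * D \<in> Mat r r" using X' Dm by blast
  have L': "L' \<in> Mat k r" unfolding L'_def using L XDm k
    by (intro Mat_mult[of _ k t] Mat_mult[of L t r] Mat_band Mat_diff Mat_idm) auto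
  have DX': "D * X' = idm s" unfolding X'_def using le
    by (simp add: algebra_simps rules min_absorb1 min_absorb2)
  have DZ: "D * Z = 0" unfolding Z_def by (simp add: rules idm_mult_coshift)
  have LX': "L' * X' = 0"
    unfolding L'_def using DX' X' by (simp add: algebra_simps MatD MatD[OF X', THEN assoc_rule])
  have csh: "idm t * coshift \<rho> k = (coshift \<rho> k :: 'a fsmat)" using k by (intro MatD(1)) auto
  have LZ: "L' * Z = idm k"
    unfolding L'_def using Z
    by (simp add: algebra_simps DZ MatD) (simp add: Z_def rules csh shift_coshift)
  define M1 where "M1 = X' + Z * shift s k"
  define L1 where "L1 = D + coshift s k * L'"
  have M1: "M1 \<in> Mat r (s + k)" unfolding M1_def using Z Mat_mono[OF X', of r "s + k"] by auto
  have L1: "L1 \<in> Mat (s + k) r" unfolding L1_def using L' Mat_mono[OF Dm, of "s + k" r] by auto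
  have LM: "L1 * M1 = idm (s + k)"
  proof -
    have "idm k * shift s k = (shift s k :: 'a fsmat)" by (intro MatD(1)) auto
    then show ?thesis unfolding L1_def M1_def
      by (simp add: algebra_simps DX' DZ LX' LZ DX'[THEN assoc_rule] DZ[THEN assoc_rule]
          LX'[THEN assoc_rule] LZ[THEN assoc_rule] coshift_shift)
  qed
  obtain M N where MN: "inverses r M N" "M * idm (s + k) = M1" "idm (s + k) * N = L1"
    using complete_to_invertible[OF M1 L1 LM] .
  have sk: "s + k \<le> r" using dim_le_if_left_inverse[OF L1 M1 LM] .
  have "D = idm s * L1" unfolding L1_def by (simp add: distrib_left e idm_mult_coshift[THEN assoc_rule])
  also have "\<dots> = idm s * N" by (simp add: MN(3)[symmetric] min_absorb1 assoc_rule[OF idm_idm])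
  finally have "D * M = idm s"
    using MN(1) sk by (simp add: inverses_def mult.assoc min_absorb1)
  moreover have "M * (idm \<rho> + coshift s k * shift \<rho> k) = Y"
  proof -
    have "idm \<rho> + coshift s k * shift \<rho> k \<in> Mat (s + k) t"
      using le k by (intro Mat_add Mat_mult[of _ "s + k" k] Mat_idm Mat_coshift Mat_band) auto
    then have "M * (idm \<rho> + coshift s k * shift \<rho> k) = M1 * (idm \<rho> + coshift s k * shift \<rho> k)"
      using MN(2) by (metis MatD(1) mult.assoc)
    also have "\<dots> = X' * idm \<rho> + Y * (coshift \<rho> k * shift \<rho> k)"
    proof -
      have a: "X' * coshift s k = 0"
        using idm_mult_coshift[of s s k] MatD(2)[OF X'] by (metis mult.assoc mult_zero_right order_refl)
      have b: "shift s k * idm \<rho> = (0 :: 'a fsmat)" using le by (intro shift_mult_idm)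
      have c: "idm k * shift \<rho> k = (shift \<rho> k :: 'a fsmat)" by (intro MatD(1)) auto
      show ?thesis unfolding M1_def
        by (simp add: algebra_simps a a[THEN assoc_rule] b c shift_coshift[THEN assoc_rule] Z_def)
    qed
    also have "X' * idm \<rho> = Y * idm \<rho>" unfolding X'_def
      using le by (simp add: algebra_simps min_absorb1 min_absorb2)
    also have "Y * idm \<rho> + Y * (coshift \<rho> k * shift \<rho> k) = Y"
      by (simp add: coshift_shift k algebra_simps e)
    finally show ?thesis .
  qed
  ultimately show ?thesis using that[OF MN(1)] sk le k by (auto simp: k_def)
qed

definition has_rank :: "nat \<Rightarrow> nat \<Rightarrow> 'a :: ring_1 fsmat \<Rightarrow> nat \<Rightarrow> bool" where
  "has_rank m n A r \<longleftrightarrow> (\<exists>B\<in>inj_mats m r. \<exists>C\<in>surj_mats r n. A = B * C)"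

lemma inj_mats_mult_inverses:
  assumes "Y \<in> inj_mats r t" "inverses t P Q"
  shows "Y * P \<in> inj_mats r t"
proof -
  obtain L where "Y \<in> Mat r t" "L \<in> Mat t r" and LY: "L * Y = idm t" using assms(1) by (rule inj_matsE)
  then show ?thesis using assms(2)
    by (intro inj_matsI[of _ _ _ "Q * L"]) (auto simp: inverses_def mult.assoc assoc_rule[OF LY] MatD)
qed

lemma surj_mats_inverses_mult:
  assumes "D \<in> surj_mats s r" "inverses s P Q"
  shows "P * D \<in> surj_mats s r"
proof -
  obtain Y where "D \<in> Mat s r" "Y \<in> Mat r s" and DY: "D * Y = idm s" using assms(1) by (rule surj_matsE)
  then show ?thesis using assms(2)
    by (intro surj_matsI[of _ _ _ "Y * Q"]) (auto simp: inverses_def mult.assoc assoc_rule[OF DY] MatD)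
qed

lemma has_rankE:
  fixes A :: "'a :: finite_field fsmat"
  assumes "has_rank s t A \<rho>"
  obtains P P' Q Q' where "inverses s P P'" "inverses t Q Q'" "A = P * (idm \<rho> * Q)"
    "P' * (A * Q') = idm \<rho>" "\<rho> \<le> s" "\<rho> \<le> t"
proof -
  obtain B C where B: "B \<in> inj_mats s \<rho>" and C: "C \<in> surj_mats \<rho> t" and A: "A = B * C"
    using assms unfolding has_rank_def by blast
  obtain P P' where P: "inverses s P P'" "P * idm \<rho> = B"
    using B by (elim inj_matsE) (metis complete_to_invertible)
  obtain Q' Q where Q: "inverses t Q' Q" "idm \<rho> * Q = C"
    using C by (elim surj_matsE) (metis complete_to_invertible)
  have le: "\<rho> \<le> s" "\<rho> \<le> t" using B C inj_mats_le surj_mats_le by blast+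
  have A': "A = P * (idm \<rho> * Q)"
    using A P(2) Q(2) by (metis idm_idm min.idem mult.assoc)
  have "P' * P = idm s" "Q * Q' = idm t" using P Q by (auto simp: inverses_def)
  then have "P' * (A * Q') = idm \<rho>"
    unfolding A' using le by (simp add: mult.assoc assoc_rule[of P' P] min_absorb1 min_absorb2)
  then show ?thesis using that P(1) inverses_sym[OF Q(1)] A' le by blast
qed

text \<open>
  Hence two factorisations of the same matrix with the same middle dimension, a surjection after
  an injection, differ by an automorphism of the middle space. This is the counterpart of Witt's
  theorem for a space that carries an injection and a surjection instead of a form.
\<close>
lemma factorisations_conjugate:
  fixes D Y :: "'a :: finite_field fsmat"
  assumes D: "D \<in> surj_mats s r" and Y: "Y \<in> inj_mats r t"
    and D': "D' \<in> surj_mats s r" and Y': "Y' \<in> inj_mats r t" and eq: "D * Y = D' * Y'"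
  obtains P Q where "inverses r P Q" "D * P = D'" "P * Y' = Y"
proof -
  have "D * Y \<in> Mat s t" using D Y by (auto simp: surj_mats_def inj_mats_def)
  then obtain \<rho> where rk: "has_rank s t (D * Y) \<rho>"
    using rank_factorisation unfolding has_rank_def by metis
  obtain U U' V V' where U: "inverses s U U'" and V: "inverses t V V'"
    and UV: "U' * (D * Y * V') = idm \<rho>" and le: "\<rho> \<le> s" "\<rho> \<le> t"
    using has_rankE[OF rk] by metis
  have DM: "U' * D \<in> surj_mats s r" "U' * D' \<in> surj_mats s r"
    using D D' surj_mats_inverses_mult inverses_sym[OF U] by blast+
  have YM: "Y * V' \<in> inj_mats r t" "Y' * V' \<in> inj_mats r t"
    using Y Y' inj_mats_mult_inverses inverses_sym[OF V] by blast+
  have p: "(U' * D) * (Y * V') = idm \<rho>" "(U' * D') * (Y' * V') = idm \<rho>"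
    using UV unfolding eq by (simp_all add: mult.assoc UV[symmetric] eq[THEN assoc_rule] eq)
  obtain M N where MN: "inverses r M N" "(U' * D) * M = idm s"
    "M * (idm \<rho> + coshift s (t - \<rho>) * shift \<rho> (t - \<rho>)) = Y * V'"
    using factorisation_frame[OF DM(1) YM(1) p(1) le] .
  obtain M' N' where MN': "inverses r M' N'" "(U' * D') * M' = idm s"
    "M' * (idm \<rho> + coshift s (t - \<rho>) * shift \<rho> (t - \<rho>)) = Y' * V'"
    using factorisation_frame[OF DM(2) YM(2) p(2) le] .
  have m: "M \<in> Mat r r" "N \<in> Mat r r" "M * N = idm r" "N * M = idm r"
    "M' \<in> Mat r r" "N' \<in> Mat r r" "M' * N' = idm r" "N' * M' = idm r"
    using MN(1) MN'(1) by (auto simp: inverses_def)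
  have "inverses r (M * N') (M' * N)"
    using m assoc_rule[OF m(8)] assoc_rule[OF m(4)] by (auto simp: inverses_def mult.assoc MatD)
  moreover have "D * (M * N') = D'"
  proof -
    have u: "U * U' = idm s" using U by (simp add: inverses_def)
    have "U' * (D * (M * N')) = U' * (D' * (M' * N'))"
      using MN(2) MN'(2) by (metis mult.assoc)
    then have "idm s * (D * (M * N')) = idm s * (D' * (M' * N'))"
      by (metis u mult.assoc)
    then show ?thesis using D D' m by (auto simp: surj_mats_def MatD MatD[THEN assoc_rule])
  qed
  moreover have "(M * N') * Y' = Y"
  proof -
    have v: "V' * V = idm t" using V by (simp add: inverses_def)
    have "(M * N') * (Y' * V') = Y * V'"
      unfolding MN(3)[symmetric] MN'(3)[symmetric] using assoc_rule[OF m(8)] m(1)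
      by (metis MatD(2) mult.assoc)
    then have "(M * N') * Y' * (V' * V) = Y * (V' * V)" by (metis mult.assoc)
    then show ?thesis unfolding v using Y Y' by (metis (lifting) MatD(2) inj_matsE mult.assoc)
  qed
  ultimately show ?thesis using that by blast
qed

section \<open>The derived pair of forms\<close>

lemma surj_mats_mult_inverses:
  assumes "F \<in> surj_mats k r" "inverses r U V"
  shows "F * U \<in> surj_mats k r"
proof -
  obtain W where W: "F \<in> Mat k r" "W \<in> Mat r k" "F * W = idm k" using assms(1) by (rule surj_matsE)
  then show ?thesis using assms(2) unfolding inverses_def
    by (intro surj_matsI[of _ _ _ "V * W"]) (auto simp: mult.assoc MatD assoc_rule[of U V])
qed

lemma rank_factorisation_unique:
  fixes B C :: "'a :: finite_field fsmat"
  assumes B: "B \<in> inj_mats m r" and C: "C \<in> surj_mats r n"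
    and B': "B' \<in> inj_mats m r'" and C': "C' \<in> surj_mats r' n" and eq: "B * C = B' * C'"
  obtains P Q where "inverses r P Q" "B' = B * P" "C' = Q * C" "r' = r"
proof -
  obtain L where Bm: "B \<in> Mat m r" and L: "L \<in> Mat r m" and LB: "L * B = idm r"
    using B by (rule inj_matsE)
  obtain L' where Bm': "B' \<in> Mat m r'" and L': "L' \<in> Mat r' m" and LB': "L' * B' = idm r'"
    using B' by (rule inj_matsE)
  obtain Y where Cm: "C \<in> Mat r n" and Y: "Y \<in> Mat n r" and CY: "C * Y = idm r"
    using C by (rule surj_matsE)
  obtain Y' where Cm': "C' \<in> Mat r' n" and Y': "Y' \<in> Mat n r'" and CY': "C' * Y' = idm r'"
    using C' by (rule surj_matsE)
  define P where "P = C * Y'"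
  define Q where "Q = L' * B"
  have P: "P \<in> Mat r r'" and Q: "Q \<in> Mat r' r" unfolding P_def Q_def using Cm Y' L' Bm by auto
  have BP: "B' = B * P" unfolding P_def
    by (metis CY' Bm' MatD(2) eq mult.assoc)
  have QC: "C' = Q * C" unfolding Q_def
    by (metis LB' Cm' MatD(1) eq mult.assoc)
  have QP: "Q * P = idm r'"
    by (metis BP LB' Q_def mult.assoc)
  have PQ: "P * Q = idm r"
  proof -
    have "B * (P * Q) * C = B * C" using BP QC eq by (simp add: mult.assoc)
    then have "L * (B * (P * Q) * C) * Y = L * (B * C) * Y" by simp
    then show ?thesis
      using P Q by (simp add: mult.assoc assoc_rule[OF LB] CY MatD assoc_rule[OF MatD(1)])
  qed
  have "r' = r"
    using dim_le_if_left_inverse[OF P Q PQ] dim_le_if_left_inverse[OF Q P QP] by simp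
  then show ?thesis using that[of P Q] P Q PQ QP BP QC by (auto simp: inverses_def)
qed

lemma has_rank_unique: "has_rank m n A r \<Longrightarrow> has_rank m n A r' \<Longrightarrow> r' = r"
  for A :: "'a :: finite_field fsmat"
  unfolding has_rank_def by (metis rank_factorisation_unique)

lemma has_rank_exists: "A \<in> Mat m n \<Longrightarrow> \<exists>r. has_rank m n A r"
  for A :: "'a :: finite_field fsmat"
  unfolding has_rank_def by (metis rank_factorisation)

lemma has_rank_0: "has_rank m n A 0 \<longleftrightarrow> A = 0" for A :: "'a :: finite_field fsmat"
proof
  assume "has_rank m n A 0"
  then obtain B C where "B \<in> inj_mats m 0" "A = B * C" unfolding has_rank_def by blast
  then have "B * idm 0 = B" by (auto elim!: inj_matsE simp del: idm_0 dest: MatD(2))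
  then show "A = 0" using \<open>A = B * C\<close> by simp
next
  assume "A = 0"
  then show "has_rank m n A 0" unfolding has_rank_def
    by (auto intro!: bexI[of _ 0] inj_matsI[of _ _ _ 0] surj_matsI[of _ _ _ 0])
qed

text \<open>The power \<open>A ^ (k + 1)\<close>: the ring has no unit, so powers start at exponent 1.\<close>
primrec power_Suc_mat :: "'a :: ring fsmat \<Rightarrow> nat \<Rightarrow> 'a fsmat" where
  "power_Suc_mat A 0 = A"
| "power_Suc_mat A (Suc k) = A * power_Suc_mat A k"

definition nilp :: "'a :: ring fsmat \<Rightarrow> bool" where
  "nilp A \<longleftrightarrow> (\<exists>k. power_Suc_mat A k = 0)"

lemma nilp_swap: "nilp (Z * W) \<longleftrightarrow> nilp (W * Z)"
proof -
  have pow: "power_Suc_mat (Z * W) (Suc k) = Z * (power_Suc_mat (W * Z) k * W)"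
    for k and Z W :: "'a fsmat"
    by (induction k) (simp_all add: mult.assoc)
  have "nilp (Z * W)" if "nilp (W * Z)" for Z W :: "'a fsmat"
    using that unfolding nilp_def by (metis pow mult_zero_left mult_zero_right)
  then show ?thesis by blast
qed

lemma not_nilp_invertible:
  fixes G :: "'a :: ring_1 fsmat"
  assumes G: "G \<in> Mat r r" and GV: "G * V = idm r" and "0 < r"
  shows "\<not> nilp G"
proof -
  have "\<exists>V. power_Suc_mat G k * V = idm r" for k
  proof (induction k)
    case (Suc k)
    then obtain W where "power_Suc_mat G k * W = idm r" by blast
    then have "power_Suc_mat G (Suc k) * (W * V) = G * (idm r * V)"
      by (simp only: power_Suc_mat.simps mult.assoc[symmetric]) (simp add: mult.assoc)
    then show ?case using G GV by (metis MatD(2) mult.assoc)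
  qed (use GV in auto)
  then show ?thesis using \<open>0 < r\<close> unfolding nilp_def
    by (metis idm_0 idm_inj mult_zero_left not_gr0)
qed

context unitary_field
begin

definition unitarily_equiv :: "nat \<Rightarrow> nat \<Rightarrow> 'a fsmat \<Rightarrow> 'a fsmat \<Rightarrow> bool" where
  "unitarily_equiv m n A A' \<longleftrightarrow> (\<exists>X Y. unitary m X \<and> unitary n Y \<and> A' = X * (A * Y\<^sup>\<dagger>))"

lemma unitarily_equiv_nilp:
  assumes A: "A \<in> Mat m n" and "unitarily_equiv m n A A'"
  shows "nilp (A' * A'\<^sup>\<dagger>) \<longleftrightarrow> nilp (A * A\<^sup>\<dagger>)"
proof -
  obtain X Y where X: "unitary m X" and Y: "unitary n Y" and A': "A' = X * (A * Y\<^sup>\<dagger>)"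
    using assms(2) unfolding unitarily_equiv_def by blast
  have Ac: "A\<^sup>\<dagger> \<in> Mat n m" using A by blast
  have "A' * A'\<^sup>\<dagger> = (X * A) * (X * A)\<^sup>\<dagger>"
    unfolding A' by (simp add: mult.assoc assoc_rule[OF unitaryD(3)[OF Y]] assoc_rule[OF MatD(1)[OF Ac]]
        assoc_rule[OF MatD(2)[OF A]])
  moreover have "(X * A)\<^sup>\<dagger> * (X * A) = A\<^sup>\<dagger> * A"
    by (simp add: mult.assoc assoc_rule[OF unitaryD(3)[OF X]] MatD[OF A])
  ultimately show ?thesis using nilp_swap by metis
qed

text \<open>
  Regard \<open>A\<close> as a map from \<open>W\<close> of dimension \<open>n\<close> to \<open>V\<close> of dimension \<open>m\<close>, and write \<open>A = B C\<close>
  through its image. The forms of \<open>V\<close> and \<open>W\<close> induce two hermitian forms, which may be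
  degenerate: \<open>B\<^sup>\<dagger> B\<close> on the image and \<open>C C\<^sup>\<dagger>\<close> on its dual. Modulo their radicals these become
  nondegenerate of dimensions \<open>t\<close> and \<open>s\<close>, with quotient maps \<open>E\<close> and \<open>D\<close>, and the derived
  matrix \<open>D E\<^sup>\<dagger>\<close> is the comparison between the two quotients.

  In terms of the operator \<open>T\<close> on the direct sum of \<open>V\<close> and \<open>W\<close> with components \<open>A\<close> and \<open>A\<^sup>\<dagger>\<close>,
  this is the restriction of \<open>T\<close> to the image of \<open>T\<^sup>2\<close>, with the form
  \<open>[T\<^sup>2 x, T\<^sup>2 y] = \<langle>x, T\<^sup>2 y\<rangle>\<close>.
\<close>
definition derived :: "nat \<Rightarrow> nat \<Rightarrow> 'a fsmat \<Rightarrow> nat \<Rightarrow> nat \<Rightarrow> nat \<Rightarrow> 'a fsmat \<Rightarrow> bool" where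
  "derived m n A r s t A1 \<longleftrightarrow> (\<exists>B C D E.
     B \<in> inj_mats m r \<and> C \<in> surj_mats r n \<and> A = B * C \<and>
     D \<in> surj_mats s r \<and> E \<in> surj_mats t r \<and>
     C * C\<^sup>\<dagger> = D\<^sup>\<dagger> * D \<and> B\<^sup>\<dagger> * B = E\<^sup>\<dagger> * E \<and> A1 = D * E\<^sup>\<dagger>)"

lemma derivedE:
  assumes "derived m n A r s t A1"
  obtains B C D E where
     "B \<in> inj_mats m r" "C \<in> surj_mats r n" "A = B * C"
     "D \<in> surj_mats s r" "E \<in> surj_mats t r"
     "C * C\<^sup>\<dagger> = D\<^sup>\<dagger> * D" "B\<^sup>\<dagger> * B = E\<^sup>\<dagger> * E" "A1 = D * E\<^sup>\<dagger>"
  using assms unfolding derived_def by blast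

lemma derived_exists:
  assumes "has_rank m n A r"
  obtains s t A1 where "derived m n A r s t A1"
proof -
  obtain B C where BC: "B \<in> inj_mats m r" "C \<in> surj_mats r n" "A = B * C"
    using assms unfolding has_rank_def by blast
  then have "B\<^sup>\<dagger> * B \<in> Mat r r" "C * C\<^sup>\<dagger> \<in> Mat r r" by (auto simp: inj_mats_def surj_mats_def)
  then obtain s t D E where "D \<in> surj_mats s r" "C * C\<^sup>\<dagger> = D\<^sup>\<dagger> * D"
      "E \<in> surj_mats t r" "B\<^sup>\<dagger> * B = E\<^sup>\<dagger> * E"
    using hermitian_factorisation[of "B\<^sup>\<dagger> * B" r] hermitian_factorisation[of "C * C\<^sup>\<dagger>" r]
    by (metis ct_ct ct_mult)
  then show ?thesis using that BC unfolding derived_def by blast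
qed

lemma derived_Mat: "derived m n A r s t A1 \<Longrightarrow> A \<in> Mat m n \<and> A1 \<in> Mat s t \<and> has_rank m n A r"
  by (elim derivedE) (auto simp: has_rank_def inj_mats_def surj_mats_def)

text \<open>The two products are \<open>Z Z\<^sup>\<dagger>\<close> and \<open>Z\<^sup>\<dagger> Z\<close> for \<open>Z = B D\<^sup>\<dagger>\<close>.\<close>
lemma derived_nilp:
  assumes "derived m n A r s t A1"
  shows "nilp (A1 * A1\<^sup>\<dagger>) \<longleftrightarrow> nilp (A * A\<^sup>\<dagger>)"
proof -
  obtain B C D E where f: "A = B * C" "C * C\<^sup>\<dagger> = D\<^sup>\<dagger> * D" "B\<^sup>\<dagger> * B = E\<^sup>\<dagger> * E" "A1 = D * E\<^sup>\<dagger>"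
    using derivedE[OF assms] by metis
  have "A * A\<^sup>\<dagger> = (B * D\<^sup>\<dagger>) * (D * B\<^sup>\<dagger>)"
    using f(2) by (simp add: f(1) mult.assoc assoc_rule[OF f(2)])
  moreover have "A1 * A1\<^sup>\<dagger> = (D * B\<^sup>\<dagger>) * (B * D\<^sup>\<dagger>)"
    by (simp add: f(4) mult.assoc assoc_rule[OF f(3)])
  ultimately show ?thesis using nilp_swap by metis
qed

text \<open>
  A subspace of dimension \<open>r\<close> and rank \<open>t\<close> spans, together with partners for its radical, a
  subspace of dimension \<open>r + (r - t)\<close>.
\<close>
lemma gram_bound:
  assumes B: "B \<in> inj_mats m r" and D: "D \<in> surj_mats t r" and eq: "B\<^sup>\<dagger> * B = D\<^sup>\<dagger> * D"
  shows "2 * r \<le> m + t"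
proof -
  have "B\<^sup>\<dagger> * B \<in> Mat r r" using B by (auto simp: inj_mats_def)
  from normalise_gram[OF this D eq] obtain P Q where PQ: "inverses r P Q"
    and gram: "Q\<^sup>\<dagger> * (B\<^sup>\<dagger> * B * Q) = idm t" and tr: "t \<le> r" by metis
  have "B * Q \<in> inj_mats m r" using inj_mats_mult_inverses[OF B inverses_sym[OF PQ]] .
  moreover have "(B * Q)\<^sup>\<dagger> * (B * Q) = idm t" using gram by (simp add: mult.assoc)
  ultimately show ?thesis using adapted_frame tr by metis
qed

lemma derived_bounds:
  assumes der: "derived m n A r s t A1" and rk: "has_rank s t A1 \<rho>"
  shows "s \<le> r" "t \<le> r" "2 * r \<le> m + t" "2 * r \<le> n + s" "s + t \<le> r + \<rho>"
proof -
  obtain B C D E where f: "B \<in> inj_mats m r" "C \<in> surj_mats r n" "A = B * C"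
     "D \<in> surj_mats s r" "E \<in> surj_mats t r"
     "C * C\<^sup>\<dagger> = D\<^sup>\<dagger> * D" "B\<^sup>\<dagger> * B = E\<^sup>\<dagger> * E" "A1 = D * E\<^sup>\<dagger>"
    using derivedE[OF der] .
  show "s \<le> r" "t \<le> r" using f(4,5) surj_mats_le by blast+
  show "2 * r \<le> m + t" using gram_bound f(1,5,7) by blast
  show "2 * r \<le> n + s" using gram_bound[of "C\<^sup>\<dagger>" n r D s] f by (simp add: ct_surj_mats)
  obtain P P' Q Q' where P: "inverses s P P'" and Q: "inverses t Q Q'"
    and PQ: "P' * (A1 * Q') = idm \<rho>" and le: "\<rho> \<le> s" "\<rho> \<le> t"
    using has_rankE[OF rk] by metis
  have "P' * D \<in> surj_mats s r" using surj_mats_inverses_mult[OF f(4) inverses_sym[OF P]] .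
  moreover have "E\<^sup>\<dagger> * Q' \<in> inj_mats r t"
    using inj_mats_mult_inverses[OF _ inverses_sym[OF Q], of "E\<^sup>\<dagger>" r] f(5) by (simp add: ct_surj_mats)
  moreover have "(P' * D) * (E\<^sup>\<dagger> * Q') = idm \<rho>" using PQ by (simp add: f(8) mult.assoc)
  ultimately show "s + t \<le> r + \<rho>" using factorisation_frame le by metis
qed

text \<open>Nilpotency makes the rank drop: otherwise the derived matrix would be invertible.\<close>
lemma derived_rank_less:
  assumes der: "derived m n A r s t A1" and rk: "has_rank s t A1 \<rho>"
    and nil: "nilp (A * A\<^sup>\<dagger>)" and r: "0 < r"
  shows "\<rho> < r"
proof (rule ccontr)
  assume "\<not> \<rho> < r"
  obtain P P' Q Q' where P: "inverses s P P'" and Q: "inverses t Q Q'"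
    and PQ: "A1 = P * (idm \<rho> * Q)" and le: "\<rho> \<le> s" "\<rho> \<le> t"
    using has_rankE[OF rk] by metis
  have eqs: "\<rho> = r" "s = r" "t = r" using derived_bounds[OF der rk] le \<open>\<not> \<rho> < r\<close> by auto
  have A1: "A1 = P * Q" using PQ Q unfolding eqs inverses_def by (metis MatD(1))
  have inv: "Q * Q' = idm r" "P * P' = idm r" and M: "P \<in> Mat r r" "Q \<in> Mat r r" "P' \<in> Mat r r"
    using P Q by (auto simp: inverses_def eqs)
  have c: "Q' \<in> Mat r r" "Q' * Q = idm r" "P' * P = idm r"
    using P Q by (auto simp: inverses_def eqs)
  have "A1 * A1\<^sup>\<dagger> * (P'\<^sup>\<dagger> * Q'\<^sup>\<dagger> * (Q' * P')) = idm r"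
  proof -
    have "P\<^sup>\<dagger> * P'\<^sup>\<dagger> = idm r" "Q\<^sup>\<dagger> * Q'\<^sup>\<dagger> = idm r" using ct_eqD[OF c(2)] ct_eqD[OF c(3)] by simp_all
    then show ?thesis using inv M c
      by (simp add: A1 mult.assoc assoc_rule[of "P\<^sup>\<dagger>" "P'\<^sup>\<dagger>"] assoc_rule[of "Q\<^sup>\<dagger>" "Q'\<^sup>\<dagger>"] assoc_rule[OF inv(1)]
          assoc_rule[OF MatD(2)[OF M(1)]] assoc_rule[OF MatD(2)[OF M(2)]] assoc_rule[OF MatD(2)[OF Mat_ct[OF M(2)]]])
  qed
  moreover have "A1 * A1\<^sup>\<dagger> \<in> Mat r r" unfolding A1 using M by blast
  ultimately have "\<not> nilp (A1 * A1\<^sup>\<dagger>)" using not_nilp_invertible r by blast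
  then show False using derived_nilp[OF der] nil by simp
qed

text \<open>
  Deriving is well defined on equivalence classes: rank factorisations are unique up to a
  change of basis of the image, and the factors of the two forms up to isometry.
\<close>
lemma derived_unique:
  assumes der: "derived m n A r s t A1" and der': "derived m n A' r' s' t' A1'"
    and equ: "unitarily_equiv m n A A'"
  shows "r' = r" "s' = s" "t' = t" "unitarily_equiv s t A1 A1'"
proof -
  obtain X Y where X: "unitary m X" and Y: "unitary n Y" and A': "A' = X * (A * Y\<^sup>\<dagger>)"
    using equ unfolding unitarily_equiv_def by blast
  obtain B C D E where f: "B \<in> inj_mats m r" "C \<in> surj_mats r n" "A = B * C"
     "D \<in> surj_mats s r" "E \<in> surj_mats t r"
     "C * C\<^sup>\<dagger> = D\<^sup>\<dagger> * D" "B\<^sup>\<dagger> * B = E\<^sup>\<dagger> * E" "A1 = D * E\<^sup>\<dagger>"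
    using derivedE[OF der] .
  obtain B' C' D' E' where g: "B' \<in> inj_mats m r'" "C' \<in> surj_mats r' n" "A' = B' * C'"
     "D' \<in> surj_mats s' r'" "E' \<in> surj_mats t' r'"
     "C' * C'\<^sup>\<dagger> = D'\<^sup>\<dagger> * D'" "B'\<^sup>\<dagger> * B' = E'\<^sup>\<dagger> * E'" "A1' = D' * E'\<^sup>\<dagger>"
    using derivedE[OF der'] .
  have Bm: "B \<in> Mat m r" and Cm: "C \<in> Mat r n" using f by (auto simp: inj_mats_def surj_mats_def)
  have XB: "X * B \<in> inj_mats m r"
  proof -
    obtain L where L: "L \<in> Mat r m" "L * B = idm r" using f(1) by (rule inj_matsE)
    show ?thesis using unitaryD[OF X] L Bm
      by (intro inj_matsI[of _ _ _ "L * X\<^sup>\<dagger>"])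
        (auto simp: mult.assoc assoc_rule[OF unitaryD(3)[OF X]] MatD)
  qed
  have CY: "C * Y\<^sup>\<dagger> \<in> surj_mats r n"
  proof -
    obtain W where W: "W \<in> Mat n r" "C * W = idm r" using f(2) by (rule surj_matsE)
    show ?thesis using unitaryD[OF Y] W Cm
      by (intro surj_matsI[of _ _ _ "Y * W"])
        (auto simp: mult.assoc assoc_rule[OF unitaryD(3)[OF Y]] MatD)
  qed
  have "(X * B) * (C * Y\<^sup>\<dagger>) = B' * C'" using A' f(3) g(3) by (simp add: mult.assoc)
  then obtain P Q where PQ: "inverses r P Q" and B': "B' = X * B * P" and C': "C' = Q * (C * Y\<^sup>\<dagger>)"
    and r: "r' = r"
    using rank_factorisation_unique[OF XB CY g(1,2)] by metis
  have PQm: "P \<in> Mat r r" "Q \<in> Mat r r" "P * Q = idm r" "Q * P = idm r" using PQ by (auto simp: inverses_def)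
  show "r' = r" by (rule r)
  have "B'\<^sup>\<dagger> * B' = P\<^sup>\<dagger> * (B\<^sup>\<dagger> * B) * P"
    unfolding B' using Bm by (simp add: mult.assoc assoc_rule[OF unitaryD(3)[OF X]] MatD assoc_rule[OF MatD(1)[OF Bm]])
  then have gE: "(E * P)\<^sup>\<dagger> * (E * P) = E'\<^sup>\<dagger> * E'" using f(7) g(7) by (simp add: mult.assoc)
  have "C' * C'\<^sup>\<dagger> = Q * (C * C\<^sup>\<dagger>) * Q\<^sup>\<dagger>"
    unfolding C' using Cm by (simp add: mult.assoc assoc_rule[OF unitaryD(3)[OF Y]] assoc_rule[OF MatD(2)[OF Cm]])
  then have gD: "(D * Q\<^sup>\<dagger>)\<^sup>\<dagger> * (D * Q\<^sup>\<dagger>) = D'\<^sup>\<dagger> * D'" using f(6) g(6) by (simp add: mult.assoc)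
  have "E * P \<in> surj_mats t r" using surj_mats_mult_inverses f(5) PQ by blast
  then obtain V where V: "V \<in> Mat t t" "V\<^sup>\<dagger> * V = idm t" "E' = V * (E * P)" and t: "t' = t"
    using hermitian_factorisation_unique[OF _ _ gE] g(5) r by metis
  have "inverses r (Q\<^sup>\<dagger>) (P\<^sup>\<dagger>)" using PQm ct_eqD[OF PQm(3)] ct_eqD[OF PQm(4)] by (auto simp: inverses_def)
  then have "D * Q\<^sup>\<dagger> \<in> surj_mats s r" using surj_mats_mult_inverses f(4) by blast
  then obtain U where U: "U \<in> Mat s s" "U\<^sup>\<dagger> * U = idm s" "D' = U * (D * Q\<^sup>\<dagger>)" and s: "s' = s"
    using hermitian_factorisation_unique[OF _ _ gD] g(4) r by metis
  show "s' = s" "t' = t" by (rule s t)+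
  have "E\<^sup>\<dagger> \<in> Mat r t" using f(5) by (auto simp: surj_mats_def)
  then have "A1' = U * (A1 * V\<^sup>\<dagger>)"
    using ct_eqD[OF PQm(3)] unfolding g(8) U(3) V(3) f(8)
    by (simp add: mult.assoc assoc_rule[of "Q\<^sup>\<dagger>" "P\<^sup>\<dagger>" "idm r"] assoc_rule[OF MatD(1)])
  then show "unitarily_equiv s t A1 A1'"
    unfolding unitarily_equiv_def using unitaryI[OF U(1,2)] unitaryI[OF V(1,2)] by blast
qed

text \<open>
  The conjugacy of factorisations yields one change of basis of the image that matches the forms
  on the image and on its dual simultaneously. Witt's theorem lifts the resulting isometries
  from the image to \<open>V\<close> and from its dual to \<open>W\<close>.
\<close>
lemma derived_reflects_equiv:
  assumes der: "derived m n A r s t A1" and der': "derived m n A' r s t A1'"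
    and equ: "unitarily_equiv s t A1 A1'"
  shows "unitarily_equiv m n A A'"
proof -
  obtain U V where U: "unitary s U" and V: "unitary t V" and A1': "A1' = U * (A1 * V\<^sup>\<dagger>)"
    using equ unfolding unitarily_equiv_def by blast
  obtain B C D0 E0 where f: "B \<in> inj_mats m r" "C \<in> surj_mats r n" "A = B * C"
     "D0 \<in> surj_mats s r" "E0 \<in> surj_mats t r"
     "C * C\<^sup>\<dagger> = D0\<^sup>\<dagger> * D0" "B\<^sup>\<dagger> * B = E0\<^sup>\<dagger> * E0" "A1 = D0 * E0\<^sup>\<dagger>"
    using derivedE[OF der] .
  obtain B' C' D' E' where g: "B' \<in> inj_mats m r" "C' \<in> surj_mats r n" "A' = B' * C'"
     "D' \<in> surj_mats s r" "E' \<in> surj_mats t r"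
     "C' * C'\<^sup>\<dagger> = D'\<^sup>\<dagger> * D'" "B'\<^sup>\<dagger> * B' = E'\<^sup>\<dagger> * E'" "A1' = D' * E'\<^sup>\<dagger>"
    using derivedE[OF der'] .
  define D where "D = U * D0"
  define E where "E = V * E0"
  have "inverses s U (U\<^sup>\<dagger>)" "inverses t V (V\<^sup>\<dagger>)"
    using unitaryD[OF U] unitaryD[OF V] by (auto simp: inverses_def)
  then have D: "D \<in> surj_mats s r" and E: "E \<in> surj_mats t r"
    unfolding D_def E_def using f(4,5) surj_mats_inverses_mult by blast+
  have D0m: "D0 \<in> Mat s r" and E0m: "E0 \<in> Mat t r" using f(4,5) by (auto simp: surj_mats_def)
  have DD: "D\<^sup>\<dagger> * D = C * C\<^sup>\<dagger>"
    unfolding D_def f(6) by (simp add: mult.assoc assoc_rule[OF unitaryD(3)[OF U]] MatD[OF D0m])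
  have EE: "E\<^sup>\<dagger> * E = B\<^sup>\<dagger> * B"
    unfolding E_def f(7) by (simp add: mult.assoc assoc_rule[OF unitaryD(3)[OF V]] MatD[OF E0m])
  have "D * E\<^sup>\<dagger> = D' * E'\<^sup>\<dagger>"
    using A1' unfolding g(8) f(8) D_def E_def by (simp add: mult.assoc)
  moreover have "E\<^sup>\<dagger> \<in> inj_mats r t" "E'\<^sup>\<dagger> \<in> inj_mats r t" using E g(5) by (simp_all add: ct_surj_mats)
  ultimately obtain P Q where PQ: "inverses r P Q" and DP: "D * P = D'" and PE: "P * E'\<^sup>\<dagger> = E\<^sup>\<dagger>"
    using factorisations_conjugate[OF D _ g(4)] by metis
  have PQm: "P \<in> Mat r r" "Q \<in> Mat r r" "P * Q = idm r" "Q * P = idm r"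
    using PQ by (auto simp: inverses_def)
  have PQc: "Q\<^sup>\<dagger> * P\<^sup>\<dagger> = idm r" "P\<^sup>\<dagger> * Q\<^sup>\<dagger> = idm r"
    using ct_eqD[OF PQm(3)] ct_eqD[OF PQm(4)] by auto
  have Em': "E'\<^sup>\<dagger> \<in> Mat r t" using g(5) by (auto simp: surj_mats_def)
  have "Q * E\<^sup>\<dagger> = E'\<^sup>\<dagger>" using PE PQm(4) Em' by (metis MatD(1) mult.assoc)
  then have E': "E' = E * Q\<^sup>\<dagger>" by (metis ct_ct ct_mult)
  have iP: "inverses r (P\<^sup>\<dagger>) (Q\<^sup>\<dagger>)" using PQm PQc by (auto simp: inverses_def)
  have BQ: "B * Q\<^sup>\<dagger> \<in> inj_mats m r" using inj_mats_mult_inverses[OF f(1) inverses_sym[OF iP]] .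
  have "(B * Q\<^sup>\<dagger>)\<^sup>\<dagger> * (B * Q\<^sup>\<dagger>) = B'\<^sup>\<dagger> * B'"
    unfolding g(7) E' by (simp add: mult.assoc assoc_rule[OF EE])
  then obtain X where X: "unitary m X" "B' = X * (B * Q\<^sup>\<dagger>)"
    using witt[OF BQ g(1)] by metis
  have "(P\<^sup>\<dagger> * C)\<^sup>\<dagger> \<in> inj_mats n r"
    using surj_mats_inverses_mult[OF f(2) iP] by (simp only: ct_surj_mats)
  moreover have "C'\<^sup>\<dagger> \<in> inj_mats n r" using g(2) by (simp add: ct_surj_mats)
  moreover have "((P\<^sup>\<dagger> * C)\<^sup>\<dagger>)\<^sup>\<dagger> * (P\<^sup>\<dagger> * C)\<^sup>\<dagger> = (C'\<^sup>\<dagger>)\<^sup>\<dagger> * C'\<^sup>\<dagger>"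
    using g(6) DP by (auto simp: mult.assoc assoc_rule[OF DD[symmetric]])
  ultimately obtain Y where Y: "unitary n Y" "C'\<^sup>\<dagger> = Y * (P\<^sup>\<dagger> * C)\<^sup>\<dagger>"
    using witt by metis
  then have C': "C' = P\<^sup>\<dagger> * (C * Y\<^sup>\<dagger>)" by (metis ct_ct ct_mult mult.assoc)
  have Cm: "C \<in> Mat r n" using f(2) by (auto simp: surj_mats_def)
  have "A' = X * (A * Y\<^sup>\<dagger>)"
    unfolding g(3) X(2) C' f(3) by (simp add: mult.assoc assoc_rule[OF PQc(1)] assoc_rule[OF MatD(1)[OF Cm]])
  then show ?thesis using X(1) Y(1) unfolding unitarily_equiv_def by blast
qed

text \<open>
  A form of rank \<open>t\<close> on a space of dimension \<open>r\<close> embeds isometrically into the standard form as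
  soon as there are \<open>r - t\<close> spare coordinates: each radical vector is realised as
  \<open>(1, a)\<close> with \<open>a a\<^sup>q = -1\<close>.
\<close>
lemma realise_gram:
  assumes D: "D \<in> surj_mats t r" and le: "2 * r \<le> m + t"
  obtains B where "B \<in> inj_mats m r" "B\<^sup>\<dagger> * B = D\<^sup>\<dagger> * D"
proof -
  define k where "k = r - t"
  have "D\<^sup>\<dagger> * D \<in> Mat r r" using D by (auto simp: surj_mats_def)
  then obtain P Q where PQ: "inverses r P Q" and DP: "D = idm t * P" and tr: "t \<le> r"
    using normalise_gram[OF _ D refl] by metis
  have k: "t + k = r" "r + k \<le> m" using le tr by (auto simp: k_def)
  obtain a :: 'a where a: "a * a ^ q = -1"
    using norm_surj[of "-1"] frobenius_minus[of 1] by auto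
  define B0 where "B0 = idm r + coshift r k * (band a 0 k * shift t k)"
  have B0m: "B0 \<in> Mat m r" unfolding B0_def using k
    by (intro Mat_add Mat_mult[of _ m k] Mat_mult[of _ k k] Mat_idm Mat_coshift Mat_band) auto
  have rB: "idm r * B0 = idm r"
    unfolding B0_def using idm_mult_coshift[of r r k, THEN assoc_rule] by (simp add: distrib_left)
  have Br: "B0\<^sup>\<dagger> * idm r = idm r" using ct_eqD[OF rB] by simp
  have "band (a ^ q) 0 k * band a 0 k = - idm k"
    by (rule fsmat_eqI) (use a in \<open>auto simp: ent_band_mult band.rep_eq mult.commute\<close>)
  moreover have "idm k * band a 0 k = band a 0 k" "idm k * shift t k = (shift t k :: 'a fsmat)"
    using k by (auto intro!: MatD(1))
  moreover have "shift r k * idm r = (0 :: 'a fsmat)" "idm r * coshift r k = (0 :: 'a fsmat)"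
    by (auto simp: shift_mult_idm idm_mult_coshift)
  ultimately have "B0\<^sup>\<dagger> * B0 = idm t"
    unfolding B0_def using k coshift_shift[of t k, where ?'a = 'a]
    by (simp add: algebra_simps ct_band_0 assoc_rule[of "shift r k" "idm r"]
        assoc_rule[of "idm r" "coshift r k"] shift_coshift[THEN assoc_rule]
        assoc_rule[of "idm k" "band a 0 k"] assoc_rule[of "band (a ^ q) 0 k" "band a 0 k"])
  then have "(B0 * P)\<^sup>\<dagger> * (B0 * P) = D\<^sup>\<dagger> * D"
    unfolding DP by (simp add: mult.assoc assoc_rule[of "B0\<^sup>\<dagger>" B0 "idm t"])
  moreover have "B0 \<in> inj_mats m r"
    using B0m rB k by (intro inj_matsI[of _ _ _ "idm r"]) auto
  then have "B0 * P \<in> inj_mats m r" using PQ inj_mats_mult_inverses by blast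
  ultimately show ?thesis using that by blast
qed

text \<open>
  The inequalities of \<open>derived_bounds\<close> are sufficient as well: the normal form of
  \<open>factorisation_frame\<close> provides a middle space of any admissible dimension \<open>r\<close>, and the forms
  that it inherits embed into \<open>V\<close> and \<open>W\<close>.
\<close>
lemma derived_surj:
  assumes rk: "has_rank s t A1 \<rho>"
    and le: "s \<le> r" "t \<le> r" "s + t \<le> r + \<rho>" "2 * r \<le> m + t" "2 * r \<le> n + s"
  obtains A where "derived m n A r s t A1"
proof -
  obtain P P' Q Q' where P: "inverses s P P'" and Q: "inverses t Q Q'"
    and A1: "A1 = P * (idm \<rho> * Q)" and \<rho>: "\<rho> \<le> s" "\<rho> \<le> t"
    using has_rankE[OF rk] by metis
  define k where "k = t - \<rho>"
  have k: "\<rho> + k = t" "s + k \<le> r" using \<rho> le by (auto simp: k_def)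
  define Y where "Y = (idm \<rho> + coshift s k * shift \<rho> k :: 'a fsmat)"
  have "idm s \<in> surj_mats s r" using le by (intro surj_matsI[of _ _ _ "idm s"]) auto
  then have D: "P * idm s \<in> surj_mats s r" using surj_mats_inverses_mult P by blast
  have Ym: "Y \<in> Mat r t" unfolding Y_def using k \<rho>
    by (intro Mat_add Mat_mult[of _ r k] Mat_idm Mat_coshift Mat_band) auto
  have Y: "Y \<in> inj_mats r t"
  proof (rule inj_matsI[OF Ym])
    show "idm \<rho> + coshift \<rho> k * shift s k \<in> Mat t r" using k \<rho>
      by (intro Mat_add Mat_mult[of _ t k] Mat_idm Mat_coshift Mat_band) auto
    have "idm \<rho> * coshift s k = (0 :: 'a fsmat)" "shift s k * idm \<rho> = (0 :: 'a fsmat)"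
      using \<rho> by (auto simp: idm_mult_coshift shift_mult_idm)
    moreover have "idm k * shift \<rho> k = (shift \<rho> k :: 'a fsmat)" by (intro MatD(1)) auto
    ultimately show "(idm \<rho> + coshift \<rho> k * shift s k) * Y = idm t"
      unfolding Y_def by (simp add: algebra_simps shift_coshift[THEN assoc_rule] coshift_shift k
        assoc_rule[of "idm \<rho>" "coshift s k"])
  qed
  have sY: "idm s * Y = idm \<rho>" unfolding Y_def using \<rho>
    by (simp add: distrib_left idm_mult_coshift[THEN assoc_rule] min_absorb2)
  define E where "E = (Y * Q)\<^sup>\<dagger>"
  have E: "E \<in> surj_mats t r"
    unfolding E_def ct_inj_mats using inj_mats_mult_inverses[OF Y Q] .
  have DE: "A1 = (P * idm s) * E\<^sup>\<dagger>" unfolding E_def A1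
    by (simp add: mult.assoc assoc_rule[OF sY])
  obtain B where B: "B \<in> inj_mats m r" "B\<^sup>\<dagger> * B = E\<^sup>\<dagger> * E"
    using realise_gram[OF E] le by metis
  obtain C where C: "C \<in> inj_mats n r" "C\<^sup>\<dagger> * C = (P * idm s)\<^sup>\<dagger> * (P * idm s)"
    using realise_gram[OF D] le by metis
  have "derived m n (B * C\<^sup>\<dagger>) r s t A1"
    unfolding derived_def
    by (intro exI[of _ B] exI[of _ "C\<^sup>\<dagger>"] exI[of _ "P * idm s"] exI[of _ E])
      (use B C D E DE in \<open>simp add: ct_inj_mats\<close>)
  then show ?thesis using that by blast
qed

end

section \<open>Types\<close>

type_synonym orbit_type = "nat multiset \<times> nat multiset \<times> nat multiset"

text \<open>
  A type lists the indecomposable summands of the hermitian space \<open>V + W\<close> under the nilpotent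
  operator \<open>T\<close> with components \<open>A\<close> and \<open>A\<^sup>\<dagger>\<close>, which exchanges \<open>V\<close> and \<open>W\<close>. An entry \<open>k\<close> of
  the first component is a chain \<open>x, T x, T\<^sup>2 x, \<dots>\<close> of odd length that starts in \<open>V\<close>, with
  \<open>k + 1\<close> vectors in \<open>V\<close> and \<open>k\<close> vectors in \<open>W\<close>; an entry of the second component is a chain
  with the roles of \<open>V\<close> and \<open>W\<close> exchanged. A chain of even length is isotropic, because the
  form pairs its first vector with its last and these lie in different spaces; an entry \<open>k\<close> of
  the third component is a pair of such chains of length \<open>2 * (k + 1)\<close>, one starting in \<open>V\<close> and
  one in \<open>W\<close>, in duality with each other.
\<close>

fun dimV :: "orbit_type \<Rightarrow> nat" where
  "dimV (K, L, N) = \<Sum>\<^sub># K + size K + \<Sum>\<^sub># L + 2 * (\<Sum>\<^sub># N + size N)"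

fun dimW :: "orbit_type \<Rightarrow> nat" where
  "dimW (K, L, N) = \<Sum>\<^sub># K + \<Sum>\<^sub># L + size L + 2 * (\<Sum>\<^sub># N + size N)"

fun type_rank :: "orbit_type \<Rightarrow> nat" where
  "type_rank (K, L, N) = \<Sum>\<^sub># K + \<Sum>\<^sub># L + 2 * \<Sum>\<^sub># N + size N"

definition prolong :: "nat \<Rightarrow> nat multiset \<Rightarrow> nat multiset" where
  "prolong a K = replicate_mset a 0 + image_mset Suc K"

text \<open>
  Deriving removes the two end vectors of every chain and with them the chains of length 1 and 2;
  this is the reverse process, which adds \<open>a\<close> and \<open>b\<close> chains of length 1 in \<open>V\<close> and in \<open>W\<close>,
  and \<open>c\<close> pairs of chains of length 2.
\<close>
fun grow :: "nat \<Rightarrow> nat \<Rightarrow> nat \<Rightarrow> orbit_type \<Rightarrow> orbit_type" where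
  "grow a b c (K, L, N) = (prolong a K, prolong b L, prolong c N)"

lemma sum_mset_image_Suc: "\<Sum>\<^sub># (image_mset Suc K) = \<Sum>\<^sub># K + size K"
  by (induction K) auto

lemma sum_prolong [simp]: "\<Sum>\<^sub># (prolong a K) = \<Sum>\<^sub># K + size K"
proof -
  have "\<Sum>\<^sub># (replicate_mset a (0 :: nat)) = 0" by (induction a) auto
  then show ?thesis by (simp add: prolong_def sum_mset_image_Suc)
qed

lemma size_prolong [simp]: "size (prolong a K) = a + size K"
  by (simp add: prolong_def)

lemma prolong_inj: "prolong a K = prolong b L \<longleftrightarrow> a = b \<and> K = L"
proof
  assume eq: "prolong a K = prolong b L"
  have z: "count (image_mset Suc M) 0 = 0" for M by (simp add: count_eq_zero_iff)
  have p: "image_mset (\<lambda>n. n - 1) (filter_mset (\<lambda>n. 0 < n) (prolong a K)) = K" for a K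
  proof -
    have zeros: "filter_mset (\<lambda>n. 0 < n) (replicate_mset a (0 :: nat)) = {#}" by (simp add: in_replicate_mset)
    have "image_mset (\<lambda>n. n - 1) (filter_mset (\<lambda>n. 0 < n) (image_mset Suc K)) = K"
      by (induction K) auto
    then show ?thesis unfolding prolong_def filter_union_mset zeros by (simp only: add_0)
  qed
  have "count (prolong a K) 0 = a" for a K by (simp add: prolong_def z)
  then show "a = b \<and> K = L" using eq p by metis
qed auto

lemma prolong_cases: obtains a K where "M = prolong a K"
proof -
  have "\<exists>a K. M = prolong a K"
  proof (induction M)
    case empty
    have "{#} = prolong 0 {#}" by (simp add: prolong_def)
    then show ?case by blast
  next
    case (add x M)
    then obtain a K where M: "M = prolong a K" by blast
    have "add_mset x M = (case x of 0 \<Rightarrow> prolong (Suc a) K | Suc y \<Rightarrow> prolong a (add_mset y K))"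
      by (simp add: M prolong_def split: nat.split)
    then show ?case by (metis nat.exhaust nat.simps(4,5))
  qed
  then show ?thesis using that by blast
qed

lemma grow_inj: "grow a b c \<tau> = grow a' b' c' \<tau>' \<longleftrightarrow> a = a' \<and> b = b' \<and> c = c' \<and> \<tau> = \<tau>'"
  by (cases \<tau>; cases \<tau>') (auto simp: prolong_inj)

lemma grow_cases: obtains a b c \<tau>' where "\<tau> = grow a b c \<tau>'"
  by (metis grow.simps prolong_cases prod_cases3)

text \<open>Solved for \<open>a\<close>, \<open>b\<close> and \<open>c\<close>, these are the slacks in the inequalities of \<open>derived_bounds\<close>.\<close>
lemma dim_grow:
  "dimV (grow a b c \<tau>) + 2 * type_rank \<tau> = a + 2 * dimV \<tau> + dimW \<tau> + 2 * c"
  "dimW (grow a b c \<tau>) + 2 * type_rank \<tau> = b + 2 * dimW \<tau> + dimV \<tau> + 2 * c"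
  "type_rank (grow a b c \<tau>) + type_rank \<tau> = dimV \<tau> + dimW \<tau> + c"
  by (cases \<tau>; simp)+

abbreviation no_chains :: orbit_type where
  "no_chains \<equiv> ({#}, {#}, {#})"

lemma type_rank_le: "type_rank \<tau> \<le> dimV \<tau>" "type_rank \<tau> \<le> dimW \<tau>"
  by (cases \<tau>; simp)+

lemma type_rank_grow_le:
  assumes "type_rank (grow a b c \<tau>) \<le> type_rank \<tau>"
  shows "c = 0 \<and> \<tau> = no_chains"
  using assms by (cases \<tau>) auto

context unitary_field
begin

text \<open>
  The type is read off recursively from the dimensions: the numbers of shortest chains are the
  slacks in the inequalities of \<open>derived_bounds\<close>, and the other chains are those of the derived
  matrix. The zero matrix has chains of length 1 only.
\<close>
inductive has_type :: "nat \<Rightarrow> nat \<Rightarrow> 'a fsmat \<Rightarrow> orbit_type \<Rightarrow> bool" where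
  zero: "has_type m n 0 (grow m n 0 no_chains)"
| step: "has_type m n A (grow (m + t - 2 * r) (n + s - 2 * r) (r + type_rank \<tau> - (s + t)) \<tau>)"
    if "derived m n A r s t A1" "0 < r" "has_type s t A1 \<tau>"

lemma has_type_dims:
  assumes "has_type m n A \<tau>"
  shows "A \<in> Mat m n \<and> nilp (A * A\<^sup>\<dagger>) \<and> dimV \<tau> = m \<and> dimW \<tau> = n \<and> has_rank m n A (type_rank \<tau>)"
  using assms
proof induction
  case (zero m n)
  have "nilp (0 :: 'a fsmat)" unfolding nilp_def by (rule exI[of _ 0]) simp
  then show ?case by (simp add: has_rank_0)
next
  case (step m n A r s t A1 \<tau>)
  note b = derived_bounds[OF step(1), of "type_rank \<tau>"]
  have IH: "dimV \<tau> = s" "dimW \<tau> = t" "nilp (A1 * A1\<^sup>\<dagger>)" and rk: "has_rank s t A1 (type_rank \<tau>)"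
    using step.IH by auto
  let ?\<tau>' = "grow (m + t - 2 * r) (n + s - 2 * r) (r + type_rank \<tau> - (s + t)) \<tau>"
  have "type_rank ?\<tau>' = r" "dimV ?\<tau>' = m" "dimW ?\<tau>' = n"
    using dim_grow[of "m + t - 2 * r" "n + s - 2 * r" "r + type_rank \<tau> - (s + t)" \<tau>] IH(1,2)
      b[OF rk] by linarith+
  then show ?case
    using derived_Mat[OF step(1)] derived_nilp[OF step(1)] IH(3) by simp
qed

text \<open>The recursion ends because nilpotency is inherited and makes the rank decrease.\<close>
lemma has_type_exists:
  assumes "A \<in> Mat m n" and "nilp (A * A\<^sup>\<dagger>)"
  shows "\<exists>\<tau>. has_type m n A \<tau>"
proof -
  obtain r where "has_rank m n A r" using has_rank_exists assms(1) by blast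
  then show ?thesis using assms
  proof (induction r arbitrary: m n A rule: less_induct)
    case (less r)
    show ?case
    proof (cases "r = 0")
      case True
      then have "A = 0" using less.prems(1) has_rank_0 by metis
      then show ?thesis using has_type.zero by blast
    next
      case False
      obtain s t A1 where der: "derived m n A r s t A1" using derived_exists less.prems(1) by blast
      then have A1: "A1 \<in> Mat s t" using derived_Mat by blast
      then obtain \<rho> where \<rho>: "has_rank s t A1 \<rho>" using has_rank_exists by blast
      have "\<rho> < r" using derived_rank_less[OF der \<rho>] less.prems False by simp
      then obtain \<tau> where "has_type s t A1 \<tau>"
        using less.IH[OF _ \<rho> A1] derived_nilp[OF der] less.prems by blast
      then show ?thesis using has_type.step[OF der] False by blast
    qed
  qed
qed

lemma unitarily_equiv_0: "unitarily_equiv m n 0 A \<Longrightarrow> A = 0"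
  by (auto simp: unitarily_equiv_def)

lemma unitarily_equiv_sym:
  assumes "A \<in> Mat m n" "unitarily_equiv m n A A'"
  shows "unitarily_equiv m n A' A"
proof -
  obtain X Y where X: "unitary m X" and Y: "unitary n Y" and A': "A' = X * (A * Y\<^sup>\<dagger>)"
    using assms(2) unfolding unitarily_equiv_def by blast
  have "A = X\<^sup>\<dagger> * (A' * Y)" unfolding A' using assms(1)
    by (simp add: mult.assoc unitaryD(3)[OF Y] assoc_rule[OF unitaryD(3)[OF X]] MatD)
  then show ?thesis unfolding unitarily_equiv_def
    using unitary_ct[OF X] unitary_ct[OF Y] by (metis ct_ct)
qed

lemma has_type_unique:
  assumes "has_type m n A \<tau>" "has_type m n A' \<tau>'" "unitarily_equiv m n A A'"
  shows "\<tau>' = \<tau>"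
  using assms
proof (induction arbitrary: A' \<tau>')
  case (zero m n)
  then have "A' = 0" using unitarily_equiv_0 by blast
  from zero(1) show ?case
  proof cases
    case (step r s t A1 \<tau>)
    then have "has_rank m n A' r" using derived_Mat by blast
    then have "r = 0" using \<open>A' = 0\<close> has_rank_0 has_rank_unique by metis
    then show ?thesis using step by simp
  qed simp
next
  case (step m n A r s t A1 \<tau>)
  note der = step.hyps(1)
  from step.prems(1) show ?case
  proof cases
    case zero
    then have "A = 0" using step.prems(2) derived_Mat[OF der] unitarily_equiv_sym unitarily_equiv_0
      by blast
    then have "r = 0" using derived_Mat[OF der] has_rank_0 has_rank_unique by metis
    then show ?thesis using step.hyps(2) by simp
  next
    case (step r' s' t' A1' \<tau>1)
    note u = derived_unique[OF der step(2) \<open>unitarily_equiv m n A A'\<close>]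
    have "has_type s t A1' \<tau>1" using step(4) u by simp
    then have "\<tau>1 = \<tau>" using step.IH u(4) by blast
    then show ?thesis using u step(1) by simp
  qed
qed

lemma has_type_inj:
  assumes "has_type m n A \<tau>" "has_type m n A' \<tau>"
  shows "unitarily_equiv m n A A'"
  using assms
proof (induction arbitrary: A')
  case (zero m n)
  have "has_rank m n A' 0" using has_type_dims[OF zero] by simp
  then have "A' = 0" by (simp add: has_rank_0)
  then show ?case unfolding unitarily_equiv_def using unitary_idm by auto
next
  case (step m n A r s t A1 \<tau>)
  let ?\<tau>' = "grow (m + t - 2 * r) (n + s - 2 * r) (r + type_rank \<tau> - (s + t)) \<tau>"
  note der = step.hyps(1)
  have "has_type m n A ?\<tau>'" using step.hyps by (rule has_type.step)
  then have r: "r = type_rank ?\<tau>'"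
    using derived_Mat[OF der] has_type_dims has_rank_unique by metis
  from step.prems show ?case
  proof cases
    case zero
    then have "has_rank m n A' 0" by (simp add: has_rank_0)
    then have "r = 0" using r has_type_dims[OF step.prems] has_rank_unique by metis
    then show ?thesis using step.hyps(2) by simp
  next
    case (step r' s' t' A1' \<tau>1)
    then have "\<tau>1 = \<tau>" by (simp add: grow_inj)
    moreover have "dimV \<tau>1 = s'" "dimW \<tau>1 = t'" using has_type_dims[OF step(4)] by auto
    moreover have "dimV \<tau> = s" "dimW \<tau> = t" using has_type_dims[OF \<open>has_type s t A1 \<tau>\<close>] by auto
    ultimately have st: "s' = s" "t' = t" by auto
    have "r' = r"
      using derived_Mat[OF step(2)] has_type_dims[OF step.prems] r has_rank_unique by metis
    then show ?thesis using derived_reflects_equiv[OF der] step step.IH st \<open>\<tau>1 = \<tau>\<close> by blast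
  qed
qed

lemma has_type_surj: "\<exists>A. has_type (dimV \<tau>) (dimW \<tau>) A \<tau>"
proof (induction "type_rank \<tau>" arbitrary: \<tau> rule: less_induct)
  case less
  obtain a b c \<tau>1 where \<tau>: "\<tau> = grow a b c \<tau>1" using grow_cases .
  show ?case
  proof (cases "type_rank \<tau> = 0")
    case True
    then have *: "c = 0" "\<tau>1 = no_chains" using type_rank_grow_le[of a b c \<tau>1] \<tau> by auto
    then have "dimV \<tau> = a" "dimW \<tau> = b" using \<tau> by auto
    then show ?thesis using has_type.zero[of a b] \<tau> * by auto
  next
    case False
    define r where "r = type_rank \<tau>"
    define m where "m = dimV \<tau>"
    define n where "n = dimW \<tau>"
    define s where "s = dimV \<tau>1"
    define t where "t = dimW \<tau>1"
    define \<rho> where "\<rho> = type_rank \<tau>1"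
    have "\<rho> < r"
    proof (rule ccontr)
      assume "\<not> \<rho> < r"
      then have "c = 0" "\<tau>1 = no_chains" using type_rank_grow_le[of a b c \<tau>1] \<tau> r_def \<rho>_def by auto
      then show False using False \<tau> by simp
    qed
    then obtain A1 where A1: "has_type s t A1 \<tau>1" using less.hyps r_def s_def t_def \<rho>_def by blast
    have "\<rho> \<le> s" "\<rho> \<le> t" using type_rank_le by (auto simp: \<rho>_def s_def t_def)
    have "has_rank s t A1 \<rho>" using has_type_dims[OF A1] by (simp add: \<rho>_def)
    have eq: "m + 2 * \<rho> = a + 2 * s + t + 2 * c" "n + 2 * \<rho> = b + 2 * t + s + 2 * c" "r + \<rho> = s + t + c"
      using dim_grow[of a b c \<tau>1] unfolding \<tau>[symmetric] m_def n_def r_def s_def t_def \<rho>_def by auto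
    have "s \<le> r" "t \<le> r" using eq \<open>\<rho> \<le> s\<close> \<open>\<rho> \<le> t\<close> by linarith+
    moreover have "s + t \<le> r + \<rho>" "2 * r \<le> m + t" "2 * r \<le> n + s" using eq by linarith+
    ultimately obtain A where "derived m n A r s t A1"
      using derived_surj[OF \<open>has_rank s t A1 \<rho>\<close>] by blast
    moreover have "0 < r" using False r_def by simp
    ultimately have "has_type m n A (grow (m + t - 2 * r) (n + s - 2 * r) (r + \<rho> - (s + t)) \<tau>1)"
      using has_type.step[OF _ _ A1] \<rho>_def by blast
    moreover have "m + t - 2 * r = a" "n + s - 2 * r = b" "r + \<rho> - (s + t) = c"
      using eq by linarith+
    ultimately show ?thesis using \<tau> unfolding m_def n_def by auto
  qed
qed

end

section \<open>Counting types\<close>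

definition types :: "nat \<Rightarrow> nat \<Rightarrow> orbit_type set" where
  "types m n = {\<tau>. dimV \<tau> = m \<and> dimW \<tau> = n}"

text \<open>Partitions of \<open>d\<close>, with every part lowered by one.\<close>
definition lowered_partitions :: "nat \<Rightarrow> nat multiset set" where
  "lowered_partitions d = {K. \<Sum>\<^sub># K + size K = d}"

lemma card_lowered_partitions: "card (lowered_partitions d) = num_partitions d"
proof -
  have "bij_betw (prolong 0) (lowered_partitions d) (partitions d)"
  proof (rule bij_betw_imageI)
    show "inj_on (prolong 0) (lowered_partitions d)" by (auto simp: inj_on_def prolong_inj)
    show "prolong 0 ` lowered_partitions d = partitions d"
    proof (intro equalityI subsetI)
      fix P assume "P \<in> prolong 0 ` lowered_partitions d"
      then obtain K where "P = prolong 0 K" "\<Sum>\<^sub># K + size K = d" by (auto simp: lowered_partitions_def)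
      then show "P \<in> partitions d"
        unfolding partitions_def using sum_prolong[of 0 K] by (auto simp: prolong_def)
    next
      fix P assume P: "P \<in> partitions d"
      obtain a K where K: "P = prolong a K" using prolong_cases .
      have "a = 0" using P K by (cases a) (auto simp: partitions_def prolong_def)
      then show "P \<in> prolong 0 ` lowered_partitions d"
        using P K sum_prolong[of 0 K] by (auto simp: lowered_partitions_def partitions_def)
    qed
  qed
  then show ?thesis unfolding num_partitions_def by (rule bij_betw_same_card)
qed

lemma finite_lowered_partitions: "finite (lowered_partitions d)"
proof -
  have "lowered_partitions d \<subseteq> (\<Union>k\<le>d. multisets_of_size {..d} k)"
  proof
    fix K assume "K \<in> lowered_partitions d"
    then have d: "\<Sum>\<^sub># K + size K = d" by (simp add: lowered_partitions_def)
    then have "x \<le> d" if "x \<in># K" for x using that sum_mset.remove[of x K] by simp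
    then show "K \<in> (\<Union>k\<le>d. multisets_of_size {..d} k)" using d by (auto simp: multisets_of_size_def)
  qed
  then show ?thesis by (rule finite_subset) auto
qed

text \<open>
  The chains of a type are recorded by partitions of \<open>m1\<close>, \<open>m2\<close> and \<open>m3\<close> whose parts are the
  numbers of vectors in \<open>V\<close>, halved for the pairs of even chains. The chains that consist of
  a single vector of \<open>W\<close>, the entries 0 of the second component, are not recorded. Their number
  is forced by \<open>n\<close>, and it is a natural number because the other chains occupy at most \<open>2 * m\<close>
  dimensions of \<open>W\<close>.
\<close>
lemma card_types:
  assumes "2 * m \<le> n"
  shows "card (types m n) = (\<Sum>(m1, m2, m3) \<in> {(m1, m2, m3). m1 + m2 + 2 * m3 = m}.
    num_partitions m1 * num_partitions m2 * num_partitions m3)"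
proof -
  let ?S = "{(m1, m2, m3). m1 + m2 + 2 * m3 = m}"
  let ?F = "\<lambda>(m1, m2, m3). lowered_partitions m1 \<times> lowered_partitions m2 \<times> lowered_partitions m3"
  let ?weight = "\<lambda>K :: nat multiset. \<Sum>\<^sub># K + size K"
  define need where "need K L N = \<Sum>\<^sub># K + ?weight L + size L + 2 * ?weight N" for K L N :: "nat multiset"
  have need: "need K L N \<le> n" if "?weight K + ?weight L + 2 * ?weight N = m" for K L N
    using that assms by (simp add: need_def)
  have S: "finite ?S"
    by (rule finite_subset[of _ "{..m} \<times> {..m} \<times> {..m}"]) auto
  let ?f = "\<lambda>(_, K, L, N). (K, prolong (n - need K L N) L, N)"
  have "bij_betw ?f (Sigma ?S ?F) (types m n)"
  proof (rule bij_betw_imageI)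
    show "inj_on ?f (Sigma ?S ?F)"
      by (auto simp: inj_on_def prolong_inj lowered_partitions_def)
    show "?f ` Sigma ?S ?F = types m n"
    proof (intro equalityI subsetI)
      fix \<tau> assume "\<tau> \<in> ?f ` Sigma ?S ?F"
      then obtain K L N where \<tau>: "\<tau> = (K, prolong (n - need K L N) L, N)"
        and "?weight K + ?weight L + 2 * ?weight N = m"
        by (auto simp: lowered_partitions_def)
      then show "\<tau> \<in> types m n" using need[of K L N] by (auto simp: types_def need_def)
    next
      fix \<tau> assume \<tau>: "\<tau> \<in> types m n"
      obtain K L' N where "\<tau> = (K, L', N)" by (cases \<tau>)
      moreover obtain b L where "L' = prolong b L" using prolong_cases .
      ultimately have \<tau>': "\<tau> = (K, prolong b L, N)" by simp
      then have w: "?weight K + ?weight L + 2 * ?weight N = m" and "b = n - need K L N"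
        using \<tau> by (auto simp: types_def need_def)
      then have "\<tau> = ?f ((?weight K, ?weight L, ?weight N), K, L, N)" using \<tau>' by simp
      moreover have "((?weight K, ?weight L, ?weight N), K, L, N) \<in> Sigma ?S ?F"
        using w by (auto simp: lowered_partitions_def)
      ultimately show "\<tau> \<in> ?f ` Sigma ?S ?F" by (rule image_eqI)
    qed
  qed
  then have "card (types m n) = card (Sigma ?S ?F)" by (rule bij_betw_same_card[symmetric])
  also have "\<dots> = (\<Sum>x\<in>?S. card (?F x))"
    by (rule card_SigmaI) (use S finite_lowered_partitions in auto)
  also have "\<dots> = (\<Sum>(m1, m2, m3) \<in> ?S. num_partitions m1 * num_partitions m2 * num_partitions m3)"
    by (rule sum.cong) (auto simp: card_cartesian_product card_lowered_partitions mult.assoc)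
  finally show ?thesis .
qed

section \<open>Orbits and types\<close>

definition of_mat :: "'a :: ring_1 mat \<Rightarrow> 'a fsmat" where
  "of_mat A = Fsmat (\<lambda>i j. if i < dim_row A \<and> j < dim_col A then A $$ (i, j) else 0)"

lemma ent_of_mat: "ent (of_mat A) i j = (if i < dim_row A \<and> j < dim_col A then A $$ (i, j) else 0)"
proof -
  have "ent (of_mat A) = (\<lambda>i j. if i < dim_row A \<and> j < dim_col A then A $$ (i, j) else 0)"
    unfolding of_mat_def
    by (rule Fsmat_inverse) (auto intro!: exI[of _ "max (dim_row A) (dim_col A)"])
  then show ?thesis by simp
qed

lemma of_mat_Mat [intro]: "A \<in> carrier_mat m n \<Longrightarrow> of_mat A \<in> Mat m n"
  by (auto simp: Mat_iff_ent ent_of_mat split: if_splits)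

lemma of_mat_eq_iff:
  assumes "A \<in> carrier_mat m n" "B \<in> carrier_mat m n"
  shows "of_mat A = of_mat B \<longleftrightarrow> A = B"
proof
  assume eq: "of_mat A = of_mat B"
  show "A = B"
  proof (rule eq_matI)
    fix i j assume "i < dim_row B" "j < dim_col B"
    then show "A $$ (i, j) = B $$ (i, j)"
      using assms arg_cong[OF eq, of "\<lambda>C. ent C i j"] by (simp add: ent_of_mat)
  qed (use assms in auto)
qed simp

lemma of_mat_surj:
  assumes "B \<in> Mat m n"
  obtains A where "A \<in> carrier_mat m n" "of_mat A = B"
proof -
  have "of_mat (mat m n (\<lambda>(i, j). ent B i j)) = B"
    by (rule fsmat_eqI) (use assms in \<open>auto simp: ent_of_mat Mat_iff_ent\<close>)
  then show ?thesis using that by (metis mat_carrier)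
qed

lemma of_mat_mult:
  assumes "A \<in> carrier_mat l m" "B \<in> carrier_mat m n"
  shows "of_mat (A * B) = of_mat A * of_mat B"
proof (rule fsmat_eqI)
  fix i j
  have "ent (of_mat A * of_mat B) i j = (\<Sum>k<m. ent (of_mat A) i k * ent (of_mat B) k j)"
    by (rule ent_mult_bound) (use assms in \<open>auto simp: ent_of_mat split: if_splits\<close>)
  then show "ent (of_mat (A * B)) i j = ent (of_mat A * of_mat B) i j"
    using assms by (auto simp: ent_of_mat scalar_prod_def lessThan_atLeast0)
qed

lemma of_mat_1: "of_mat (1\<^sub>m n) = idm n"
  by (rule fsmat_eqI) (auto simp: ent_of_mat band.rep_eq)

lemma of_mat_0: "of_mat (0\<^sub>m m n) = 0"
  by (rule fsmat_eqI) (auto simp: ent_of_mat)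

lemma nilpotent_mat_iff:
  assumes B: "(B :: 'a :: ring_1 mat) \<in> carrier_mat m m"
  shows "nilpotent_mat B \<longleftrightarrow> nilp (of_mat B)"
proof -
  have pw: "B ^\<^sub>m k \<in> carrier_mat m m" for k using B by simp
  have comm: "power_Suc_mat A (Suc k) = power_Suc_mat A k * A" for A :: "'a fsmat" and k
  proof (induction k)
    case (Suc k)
    then show ?case by (metis mult.assoc power_Suc_mat.simps(2))
  qed simp
  have *: "of_mat (B ^\<^sub>m Suc k) = power_Suc_mat (of_mat B) k" for k
  proof (induction k)
    case 0
    then show ?case using B by simp
  next
    case (Suc k)
    have "of_mat (B ^\<^sub>m Suc (Suc k)) = of_mat (B ^\<^sub>m Suc k) * of_mat B"
      using of_mat_mult[OF pw[of "Suc k"] B] by simp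
    then show ?case unfolding Suc comm .
  qed
  have "nilpotent_mat B \<longleftrightarrow> (\<exists>k. B ^\<^sub>m k = 0\<^sub>m m m)"
    using B by (auto simp: nilpotent_mat_def)
  also have "\<dots> \<longleftrightarrow> (\<exists>k. B ^\<^sub>m Suc k = 0\<^sub>m m m)"
  proof
    assume "\<exists>k. B ^\<^sub>m k = 0\<^sub>m m m"
    then obtain k where "B ^\<^sub>m k = 0\<^sub>m m m" by blast
    then have "B ^\<^sub>m Suc k = 0\<^sub>m m m" using B by simp
    then show "\<exists>k. B ^\<^sub>m Suc k = 0\<^sub>m m m" by blast
  qed blast
  also have "\<dots> \<longleftrightarrow> (\<exists>k. of_mat (B ^\<^sub>m Suc k) = of_mat (0\<^sub>m m m))"
    by (simp only: of_mat_eq_iff[OF pw zero_carrier_mat])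
  also have "\<dots> \<longleftrightarrow> nilp (of_mat B)" unfolding * of_mat_0 nilp_def ..
  finally show ?thesis .
qed

lemma conj_transpose_carrier [intro]: "A \<in> carrier_mat m n \<Longrightarrow> conj_transpose q A \<in> carrier_mat n m"
  by (simp add: conj_transpose_def)

context unitary_field
begin

lemma of_mat_conj_transpose: "of_mat (conj_transpose q A) = (of_mat A)\<^sup>\<dagger>" for A :: "'a mat"
  by (rule fsmat_eqI) (auto simp: ent_ct ent_of_mat conj_transpose_def)

lemma GU_carrier_iff:
  "X \<in> carrier (GU TYPE('a) q m) \<longleftrightarrow> X \<in> carrier_mat m m \<and> unitary m (of_mat X)"
proof
  assume "X \<in> carrier (GU TYPE('a) q m)"
  then have X: "X \<in> carrier_mat m m" "X * conj_transpose q X = 1\<^sub>m m"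
    by (auto simp: GU_def GL_def units_of_carrier Units_def ring_mat_def)
  then have "of_mat X * (of_mat X)\<^sup>\<dagger> = idm m"
    by (metis conj_transpose_carrier of_mat_1 of_mat_conj_transpose of_mat_mult)
  then show "X \<in> carrier_mat m m \<and> unitary m (of_mat X)" using X by (auto simp: unitary_def)
next
  assume X: "X \<in> carrier_mat m m \<and> unitary m (of_mat X)"
  have c: "conj_transpose q X \<in> carrier_mat m m" using X by blast
  have "of_mat (X * conj_transpose q X) = of_mat (1\<^sub>m m)" "of_mat (conj_transpose q X * X) = of_mat (1\<^sub>m m)"
    using X c unitaryD[of m "of_mat X"] by (auto simp: of_mat_mult[of _ m m _ m] of_mat_conj_transpose of_mat_1)
  then have "X * conj_transpose q X = 1\<^sub>m m" "conj_transpose q X * X = 1\<^sub>m m"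
    using X c of_mat_eq_iff[of _ m m "1\<^sub>m m"] by (meson mult_carrier_mat one_carrier_mat)+
  then show "X \<in> carrier (GU TYPE('a) q m)" using X c
    by (auto simp: GU_def GL_def units_of_carrier Units_def ring_mat_def)
qed

lemma orbit_eq:
  assumes A: "A \<in> carrier_mat m n"
  shows "orbit (GU TYPE('a) q m \<times>\<times> GU TYPE('a) q n) (GU_action q m n) A =
    {A' \<in> carrier_mat m n. unitarily_equiv m n (of_mat A) (of_mat A')}"
proof -
  have act: "of_mat (X * A * conj_transpose q Y) = of_mat X * (of_mat A * (of_mat Y)\<^sup>\<dagger>)"
    "X * A * conj_transpose q Y \<in> carrier_mat m n"
    if "X \<in> carrier_mat m m" "Y \<in> carrier_mat n n" for X Y
  proof -
    have c: "X * A \<in> carrier_mat m n" "conj_transpose q Y \<in> carrier_mat n n" using that A by auto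
    then show "X * A * conj_transpose q Y \<in> carrier_mat m n" by simp
    show "of_mat (X * A * conj_transpose q Y) = of_mat X * (of_mat A * (of_mat Y)\<^sup>\<dagger>)"
      using of_mat_mult[OF c] of_mat_mult[OF that(1) A] by (simp add: of_mat_conj_transpose mult.assoc)
  qed
  show ?thesis
  proof (intro equalityI subsetI)
    fix A' assume "A' \<in> orbit (GU TYPE('a) q m \<times>\<times> GU TYPE('a) q n) (GU_action q m n) A"
    then obtain X Y where "X \<in> carrier (GU TYPE('a) q m)" "Y \<in> carrier (GU TYPE('a) q n)"
      and "A' = X * A * conj_transpose q Y"
      using A by (auto simp: orbit_def GU_action_def DirProd_def)
    then show "A' \<in> {A' \<in> carrier_mat m n. unitarily_equiv m n (of_mat A) (of_mat A')}"
      using act[of X Y] unfolding GU_carrier_iff unitarily_equiv_def by auto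
  next
    fix A' assume "A' \<in> {A' \<in> carrier_mat m n. unitarily_equiv m n (of_mat A) (of_mat A')}"
    then obtain X' Y' where A': "A' \<in> carrier_mat m n" and X': "unitary m X'" and Y': "unitary n Y'"
      and eq: "of_mat A' = X' * (of_mat A * Y'\<^sup>\<dagger>)" unfolding unitarily_equiv_def by blast
    obtain X where X: "X \<in> carrier_mat m m" "of_mat X = X'" using of_mat_surj unitaryD(1)[OF X'] by metis
    obtain Y where Y: "Y \<in> carrier_mat n n" "of_mat Y = Y'" using of_mat_surj unitaryD(1)[OF Y'] by metis
    have "A' = X * A * conj_transpose q Y"
      using act[OF X(1) Y(1)] A' eq X(2) Y(2) of_mat_eq_iff by metis
    moreover have "X \<in> carrier (GU TYPE('a) q m)" "Y \<in> carrier (GU TYPE('a) q n)"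
      using X Y X' Y' by (auto simp: GU_carrier_iff)
    ultimately show "A' \<in> orbit (GU TYPE('a) q m \<times>\<times> GU TYPE('a) q n) (GU_action q m n) A"
      using A by (force simp: orbit_def GU_action_def DirProd_def)
  qed
qed

lemma nilpotent_gram_iff:
  assumes "A \<in> carrier_mat m n"
  shows "nilpotent_mat (A * conj_transpose q A) \<longleftrightarrow> nilp (of_mat A * (of_mat A)\<^sup>\<dagger>)"
  using assms nilpotent_mat_iff[of "A * conj_transpose q A" m]
    of_mat_mult[OF assms conj_transpose_carrier[OF assms]]
  by (simp add: of_mat_conj_transpose conj_transpose_carrier)

text \<open>
  The orbits are the classes of unitary equivalence, and on matrices with \<open>A A\<^sup>\<dagger>\<close> nilpotent the
  type exists, is a complete invariant and takes every value with the right dimensions.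
\<close>
lemma card_nilpotent_orbits: "card (nilpotent_orbits TYPE('a) q m n) = card (types m n)"
proof -
  let ?orb = "orbit (GU TYPE('a) q m \<times>\<times> GU TYPE('a) q n) (GU_action q m n)"
  let ?h = "\<lambda>\<tau>. {A \<in> carrier_mat m n. has_type m n (of_mat A) \<tau>}"
  have orb: "?orb A = ?h \<tau>" if A: "A \<in> carrier_mat m n" and \<tau>: "has_type m n (of_mat A) \<tau>" for A \<tau>
  proof -
    have "unitarily_equiv m n (of_mat A) (of_mat A') \<longleftrightarrow> has_type m n (of_mat A') \<tau>"
      if A': "A' \<in> carrier_mat m n" for A'
    proof
      assume equ: "unitarily_equiv m n (of_mat A) (of_mat A')"
      then have "nilp (of_mat A' * (of_mat A')\<^sup>\<dagger>)"
        using has_type_dims[OF \<tau>] unitarily_equiv_nilp by blast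
      then obtain \<tau>' where "has_type m n (of_mat A') \<tau>'"
        using has_type_exists[OF of_mat_Mat[OF A']] by blast
      then show "has_type m n (of_mat A') \<tau>" using has_type_unique[OF \<tau> _ equ] by blast
    qed (rule has_type_inj[OF \<tau>])
    then show ?thesis unfolding orbit_eq[OF A] by blast
  qed
  have rep: "\<exists>A\<in>carrier_mat m n. has_type m n (of_mat A) \<tau>" if \<tau>: "\<tau> \<in> types m n" for \<tau>
  proof -
    obtain B where B: "has_type m n B \<tau>" using has_type_surj[of \<tau>] \<tau> by (auto simp: types_def)
    then have "B \<in> Mat m n" using has_type_dims by blast
    then show ?thesis using of_mat_surj B by metis
  qed
  have refl: "unitarily_equiv m n B B" if "B \<in> Mat m n" for B
    unfolding unitarily_equiv_def using unitary_idm that by (metis MatD ct_idm)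
  have "bij_betw ?h (types m n) (nilpotent_orbits TYPE('a) q m n)"
  proof (rule bij_betw_imageI)
    show "inj_on ?h (types m n)"
    proof (rule inj_onI)
      fix \<tau> \<tau>' assume "\<tau> \<in> types m n" "\<tau>' \<in> types m n" "?h \<tau> = ?h \<tau>'"
      then obtain A where "A \<in> carrier_mat m n" "has_type m n (of_mat A) \<tau>" "has_type m n (of_mat A) \<tau>'"
        using rep by blast
      then show "\<tau> = \<tau>'" using has_type_unique refl by blast
    qed
    show "?h ` types m n = nilpotent_orbits TYPE('a) q m n"
    proof (intro equalityI subsetI)
      fix \<O> assume "\<O> \<in> ?h ` types m n"
      then obtain \<tau> where \<tau>: "\<tau> \<in> types m n" "\<O> = ?h \<tau>" by blast
      then obtain A where A: "A \<in> carrier_mat m n" "has_type m n (of_mat A) \<tau>" using rep by blast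
      have "\<forall>A\<in>\<O>. nilpotent_mat (A * conj_transpose q A)"
        unfolding \<tau>(2) using has_type_dims nilpotent_gram_iff by blast
      moreover have "\<O> \<in> GU_orbits TYPE('a) q m n"
        unfolding GU_orbits_def orbits_def using orb[OF A] \<tau>(2) A(1) by blast
      ultimately show "\<O> \<in> nilpotent_orbits TYPE('a) q m n" by (simp add: nilpotent_orbits_def)
    next
      fix \<O> assume \<O>: "\<O> \<in> nilpotent_orbits TYPE('a) q m n"
      then obtain A where A: "A \<in> carrier_mat m n" "\<O> = ?orb A"
        unfolding nilpotent_orbits_def GU_orbits_def orbits_def by blast
      have "A \<in> \<O>" unfolding A(2) orbit_eq[OF A(1)] using A(1) refl by blast
      then have "nilp (of_mat A * (of_mat A)\<^sup>\<dagger>)"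
        using \<O> nilpotent_gram_iff[OF A(1)] by (auto simp: nilpotent_orbits_def)
      then obtain \<tau> where \<tau>: "has_type m n (of_mat A) \<tau>" using has_type_exists A(1) by blast
      then have "\<tau> \<in> types m n" using has_type_dims by (auto simp: types_def)
      then show "\<O> \<in> ?h ` types m n" using orb[OF A(1) \<tau>] A(2) by blast
    qed
  qed
  then show ?thesis by (rule bij_betw_same_card[symmetric])
qed

end

theorem corollary5p2:
  fixes q m n :: nat
  assumes "primepow q"
    and "CARD('a :: finite_field) = q\<^sup>2"
    and "m > 0" and "n > 0" and "n \<ge> 2 * m"
  shows "card (nilpotent_orbits TYPE('a) q m n) =
    (\<Sum>(m1, m2, m3) \<in> {(m1, m2, m3). m1 + m2 + 2 * m3 = m}.
       num_partitions m1 * num_partitions m2 * num_partitions m3)"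
proof -
  interpret unitary_field q "TYPE('a)"
    using assms(1,2) by unfold_locales
  show ?thesis
    using card_nilpotent_orbits card_types[OF assms(5)] by simp
qed

end
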